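(* Let $(B_t)=(B_t^1,\dots,B_t^d)$ be a $d$-dimensional $G$-Brownian motion with associated function $G_*(A)=\frac12\inf_{\gamma\in\Gamma}\mathrm{tr}\{\gamma\gamma^TA\}$, $\Gamma\subset\mathbb{R}^{d\times d}$ nonempty, bounded and closed, and let $\overline\sigma_i^2=\mathbb{E}^*[\langle B^i\rangle_1]$, $\underline\sigma_i^2=\mathbb{E}_*[\langle B^i\rangle_1]$. If $(B_t^j)$ is independent of $(B_t^i)$ for all $1\le i<j\le d$, then (i) $u(t,x)=\mathbb{E}_*[\phi(x+B_t)]$ is the viscosity solution of $$\partial_tu(t,x)-\frac12\sum_{i=1}^d\Big[\underline\sigma_i^2(\partial_{x^ix^i}u(t,x))^+-\overline\sigma_i^2(\partial_{x^ix^i}u(t,x))^-\Big]=0,\qquad u(0,x)=\phi(x);$$ (ii) $\Gamma=\{\mathrm{diag}[\gamma_1,\dots,\gamma_d]:\ \gamma_i^2\in[\underline\sigma_i^2,\overline\sigma_i^2],\ i=1,\dots,d\}$.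
   Context: $C_{l.Lip}(\mathbb{R}^m)$: functions with $|\varphi(x)-\varphi(y)|\le C(1+|x|^k+|y|^k)|x-y|$ for some $C>0$, $k\in\mathbb{N}$; the test function $\phi$ is in $C_{l.Lip}(\mathbb{R}^d)$. $a^+=\max(a,0)$, $a^-=\max(-a,0)$. $\mathbb{E}^*$ is the sublinear $G$-expectation (Peng) on the canonical space of $\mathbb{R}^d$-valued continuous paths, $B_t(\omega)=\omega_t$, satisfying $\mathbb{E}^*[\varphi(x+B_t)]=v(t,x)$, $v$ the viscosity solution of $\partial_tv-G^*(D^2v)=0$, $v(0,\cdot)=\varphi$, $G^*(A)=\frac12\sup_{\gamma\in\Gamma}\mathrm{tr}\{\gamma\gamma^TA\}$, with increments of $B$ stationary and independent of the past; $\mathbb{E}_*[\cdot]=-\mathbb{E}^*[-\cdot]$. The set $\Gamma$ characterizes the variance uncertainty of $B$. $Y$ is independent of $X$ under $\mathbb{E}$ if $\mathbb{E}[\varphi(X,Y)]=\mathbb{E}[\mathbb{E}[\varphi(x,Y)]_{x=X}]$ for all $\varphi\in C_{l.Lip}$; for processes this is understood through finite-dimensional vectors of their values. $\langle B^i\rangle$ is the quadratic variation of $B^i$. Viscosity solution of $\partial_tu-F(D^2u)=0$, $u(0,\cdot)=\phi$: a continuous $u$ with this initial value such that for every $\psi\in C_b^{1,3}$: $\partial_t\psi-F(D^2\psi)\le0$ at points where $u-\psi$ has a local maximum and $\ge0$ where $u-\psi$ has a local minimum.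
   Formalization: (ii) as a literal equality is false (d=1, Γ={1}); proved instead: the convex hulls of {γγᵀ} over Γ and over the diagonal set coincide. In (i), u is shown to be a viscosity solution; uniqueness, which fails without a growth condition, is not claimed. *)

theory Defs
  imports "HOL-Analysis.Analysis"
begin

section \<open>Test functions and sublinear expectations\<close>

text \<open>
  The class $C_{l.Lip}$, relative to a seminorm \<open>N\<close>: with \<open>N = norm\<close> it is $C_{l.Lip}(R^m)$; with
  \<open>vec_norm n\<close> it is the class on $n$-tuples of vectors, a tuple being a sequence of which only the
  entries below \<open>n\<close> count (the estimate forces a function in the class to ignore the others).
\<close>
definition C_lLip :: "('a::minus \<Rightarrow> real) \<Rightarrow> ('a \<Rightarrow> real) set" where
  "C_lLip N = {\<phi>. \<exists>C>0. \<exists>k::nat. \<forall>x y. \<bar>\<phi> x - \<phi> y\<bar> \<le> C * (1 + N x ^ k + N y ^ k) * N (x - y)}"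

definition vec_norm :: "nat \<Rightarrow> (nat \<Rightarrow> 'a::real_normed_vector) \<Rightarrow> real" where
  "vec_norm n x = L2_set (\<lambda>i. norm (x i)) {..<n}"

definition pair_norm ::
  "nat \<Rightarrow> nat \<Rightarrow> (nat \<Rightarrow> 'a::real_normed_vector) \<times> (nat \<Rightarrow> 'b::real_normed_vector) \<Rightarrow> real" where
  "pair_norm m n = (\<lambda>(x, y). sqrt ((vec_norm m x)\<^sup>2 + (vec_norm n y)\<^sup>2))"

text \<open>\<open>L\<close> is the space of random variables on which the expectation \<open>E\<close> is considered; values of
  \<open>E\<close> outside \<open>L\<close> are irrelevant.\<close>
definition sublinear_expectation :: "('w \<Rightarrow> real) set \<Rightarrow> (('w \<Rightarrow> real) \<Rightarrow> real) \<Rightarrow> bool" where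
  "sublinear_expectation L E \<longleftrightarrow>
     (\<forall>c. (\<lambda>_. c) \<in> L) \<and>
     (\<forall>X\<in>L. \<forall>Y\<in>L. (\<lambda>\<omega>. X \<omega> + Y \<omega>) \<in> L) \<and>
     (\<forall>X\<in>L. \<forall>c. (\<lambda>\<omega>. c * X \<omega>) \<in> L) \<and>
     (\<forall>X\<in>L. (\<lambda>\<omega>. \<bar>X \<omega>\<bar>) \<in> L) \<and>
     (\<forall>c. E (\<lambda>_. c) = c) \<and>
     (\<forall>X\<in>L. \<forall>Y\<in>L. (\<forall>\<omega>. X \<omega> \<le> Y \<omega>) \<longrightarrow> E X \<le> E Y) \<and>
     (\<forall>X\<in>L. \<forall>Y\<in>L. E (\<lambda>\<omega>. X \<omega> + Y \<omega>) \<le> E X + E Y) \<and>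
     (\<forall>X\<in>L. \<forall>c\<ge>0. E (\<lambda>\<omega>. c * X \<omega>) = c * E X)"

definition lower_expectation :: "(('w \<Rightarrow> real) \<Rightarrow> real) \<Rightarrow> ('w \<Rightarrow> real) \<Rightarrow> real" where
  "lower_expectation E X = - E (\<lambda>\<omega>. - X \<omega>)"

text \<open>The random vector $(Y_0,\dots,Y_{n-1})$ is independent of $(X_0,\dots,X_{m-1})$ under \<open>E\<close>;
  the relation is not symmetric.\<close>
definition indep_vector ::
  "(('w \<Rightarrow> real) \<Rightarrow> real) \<Rightarrow> nat \<Rightarrow> (nat \<Rightarrow> 'w \<Rightarrow> 'b::real_normed_vector)
     \<Rightarrow> nat \<Rightarrow> (nat \<Rightarrow> 'w \<Rightarrow> 'a::real_normed_vector) \<Rightarrow> bool" where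
  "indep_vector E n Y m X \<longleftrightarrow>
     (\<forall>\<phi>\<in>C_lLip (pair_norm m n).
        E (\<lambda>\<omega>. \<phi> (\<lambda>k. X k \<omega>, \<lambda>k. Y k \<omega>)) =
        E (\<lambda>\<omega>. E (\<lambda>\<omega>'. \<phi> (\<lambda>k. X k \<omega>, \<lambda>k. Y k \<omega>'))))"

text \<open>The process \<open>Y\<close> is independent of the process \<open>X\<close>; time runs through $[0,\infty)$.\<close>
definition indep_process ::
  "(('w \<Rightarrow> real) \<Rightarrow> real) \<Rightarrow> (real \<Rightarrow> 'w \<Rightarrow> 'b::real_normed_vector)
     \<Rightarrow> (real \<Rightarrow> 'w \<Rightarrow> 'a::real_normed_vector) \<Rightarrow> bool" where
  "indep_process E Y X \<longleftrightarrow>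
     (\<forall>m n s t. (\<forall>k. 0 \<le> s k) \<longrightarrow> (\<forall>k. 0 \<le> t k) \<longrightarrow>
        indep_vector E n (\<lambda>k. Y (t k)) m (\<lambda>k. X (s k)))"

section \<open>Viscosity solutions\<close>

definition partial :: "'d::finite \<Rightarrow> (real^'d \<Rightarrow> real) \<Rightarrow> real^'d \<Rightarrow> real" where
  "partial i f x = deriv (\<lambda>h. f (x + h *\<^sub>R axis i 1)) 0"

definition hessian :: "(real^'d::finite \<Rightarrow> real) \<Rightarrow> real^'d \<Rightarrow> real^'d^'d" where
  "hessian f x = (\<chi> i j. partial i (partial j f) x)"

text \<open>$C_b^{1,3}$ on $(0,\infty)\times R^d$: the function, its time derivative and its spatial
  partial derivatives up to order 3 exist, are continuous and bounded. \<open>foldr partial js\<close> is the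
  iterated spatial derivative along the list of directions \<open>js\<close>.\<close>
definition C_b13 :: "(real \<Rightarrow> real^'d::finite \<Rightarrow> real) set" where
  "C_b13 = {\<psi>.
     (\<forall>js i t x. length js < 3 \<longrightarrow> 0 < t \<longrightarrow>
        (\<lambda>h. foldr partial js (\<psi> t) (x + h *\<^sub>R axis i 1)) differentiable (at 0)) \<and>
     (\<forall>js. length js \<le> 3 \<longrightarrow>
        continuous_on ({0<..} \<times> UNIV) (\<lambda>(t, x). foldr partial js (\<psi> t) x) \<and>
        bounded ((\<lambda>(t, x). foldr partial js (\<psi> t) x) ` ({0<..} \<times> UNIV))) \<and>
     (\<forall>t x. 0 < t \<longrightarrow> (\<lambda>s. \<psi> s x) differentiable (at t)) \<and>
     continuous_on ({0<..} \<times> UNIV) (\<lambda>(t, x). deriv (\<lambda>s. \<psi> s x) t) \<and>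
     bounded ((\<lambda>(t, x). deriv (\<lambda>s. \<psi> s x) t) ` ({0<..} \<times> UNIV))}"

text \<open>\<open>u\<close> is a viscosity solution of $\partial_t u - F(D^2u) = 0$ on $(0,\infty)\times R^d$ with
  $u(0,\cdot)=\phi$.\<close>
definition viscosity_solution ::
  "(real^'d^'d \<Rightarrow> real) \<Rightarrow> (real^'d::finite \<Rightarrow> real) \<Rightarrow> (real \<Rightarrow> real^'d \<Rightarrow> real) \<Rightarrow> bool" where
  "viscosity_solution F \<phi> u \<longleftrightarrow>
     continuous_on ({0..} \<times> UNIV) (\<lambda>(t, x). u t x) \<and>
     (\<forall>x. u 0 x = \<phi> x) \<and>
     (\<forall>\<psi>\<in>C_b13. \<forall>t>0. \<forall>x.
        ((\<forall>\<^sub>F (s, y) in nhds (t, x). u s y - \<psi> s y \<le> u t x - \<psi> t x) \<longrightarrow>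
           deriv (\<lambda>s. \<psi> s x) t - F (hessian (\<psi> t) x) \<le> 0) \<and>
        ((\<forall>\<^sub>F (s, y) in nhds (t, x). u s y - \<psi> s y \<ge> u t x - \<psi> t x) \<longrightarrow>
           deriv (\<lambda>s. \<psi> s x) t - F (hessian (\<psi> t) x) \<ge> 0))"

section \<open>\<open>G\<close>-expectation on the canonical path space\<close>

text \<open>Continuous paths on $[0,\infty)$ starting at 0, encoded as functions on the whole line that
  vanish at negative times.\<close>
typedef (overloaded) 'd cpath =
  "{\<omega> :: real \<Rightarrow> real^'d::finite. continuous_on UNIV \<omega> \<and> (\<forall>t\<le>0. \<omega> t = 0)}"
  by (rule exI[of _ "\<lambda>_. 0"]) auto

definition B :: "real \<Rightarrow> 'd::finite cpath \<Rightarrow> real^'d" where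
  "B t \<omega> = Rep_cpath \<omega> t"

definition L_ip :: "('d::finite cpath \<Rightarrow> real) set" where
  "L_ip = {(\<lambda>\<omega>. \<phi> (\<lambda>k. B (t k) \<omega>)) |n t \<phi>. (\<forall>k. 0 \<le> t k) \<and> \<phi> \<in> C_lLip (vec_norm n)}"

text \<open>The function $G^*$; the function $G_*$ with \<open>inf\<close> in place of \<open>sup\<close> is
  $G_*(A) = -G^*(-A)$.\<close>
definition G_upper :: "(real^'d^'d) set \<Rightarrow> real^'d^'d::finite \<Rightarrow> real" where
  "G_upper \<Gamma> A = (SUP \<gamma>\<in>\<Gamma>. trace (\<gamma> ** transpose \<gamma> ** A)) / 2"

text \<open>
  \<open>E\<close> is the \<open>G\<close>-expectation with variance uncertainty set \<open>\<Gamma>\<close>, so that \<open>B\<close> is a \<open>G\<close>-Brownian motion.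
  Its domain \<open>L\<close> is the completion $L_G^1$ of \<open>L_ip\<close> under $E|\cdot|$, realised by functions on
  the path space: \<open>L_ip\<close> is contained and dense in \<open>L\<close>, and \<open>L\<close> is complete.
\<close>
definition G_expectation ::
  "(real^'d^'d) set \<Rightarrow> ('d::finite cpath \<Rightarrow> real) set \<Rightarrow> (('d cpath \<Rightarrow> real) \<Rightarrow> real) \<Rightarrow> bool" where
  "G_expectation \<Gamma> L E \<longleftrightarrow>
     sublinear_expectation L E \<and>
     L_ip \<subseteq> L \<and>
     (\<forall>X\<in>L. \<forall>\<epsilon>>0. \<exists>Y\<in>L_ip. E (\<lambda>\<omega>. \<bar>X \<omega> - Y \<omega>\<bar>) < \<epsilon>) \<and>
     (\<forall>X :: nat \<Rightarrow> 'd cpath \<Rightarrow> real.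
        (\<forall>n. X n \<in> L) \<longrightarrow>
        (\<forall>\<epsilon>>0. \<exists>N. \<forall>m\<ge>N. \<forall>n\<ge>N. E (\<lambda>\<omega>. \<bar>X m \<omega> - X n \<omega>\<bar>) < \<epsilon>) \<longrightarrow>
        (\<exists>Y\<in>L. (\<lambda>n. E (\<lambda>\<omega>. \<bar>X n \<omega> - Y \<omega>\<bar>)) \<longlonglongrightarrow> 0)) \<and>
     (\<forall>\<phi>\<in>C_lLip norm.
        viscosity_solution (G_upper \<Gamma>) \<phi> (\<lambda>t x. E (\<lambda>\<omega>. \<phi> (x + B t \<omega>)))) \<and>
     (\<forall>\<phi>\<in>C_lLip norm. \<forall>s\<ge>0. \<forall>t\<ge>0.
        E (\<lambda>\<omega>. \<phi> (B (s + t) \<omega> - B s \<omega>)) = E (\<lambda>\<omega>. \<phi> (B t \<omega>))) \<and>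
     (\<forall>s\<ge>0. \<forall>t\<ge>0. \<forall>m r. (\<forall>k. 0 \<le> r k \<and> r k \<le> s) \<longrightarrow>
        indep_vector E 1 (\<lambda>_ \<omega>. B (s + t) \<omega> - B s \<omega>) m (\<lambda>k. B (r k)))"

text \<open>\<open>Q\<close> is the quadratic variation of the real process \<open>X\<close>: for each \<open>t\<close>, the limit in \<open>L\<close> (in the
  norm $E|\cdot|$) of the sums of squared increments over partitions of $[0,t]$ as the mesh tends
  to 0. This determines \<open>Q t\<close> up to $E|\cdot|$-null differences, hence \<open>E (Q t)\<close> uniquely.\<close>
definition quadratic_variation ::
  "('w \<Rightarrow> real) set \<Rightarrow> (('w \<Rightarrow> real) \<Rightarrow> real) \<Rightarrow> (real \<Rightarrow> 'w \<Rightarrow> real) \<Rightarrow> (real \<Rightarrow> 'w \<Rightarrow> real) \<Rightarrow> bool"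
  where
  "quadratic_variation L E X Q \<longleftrightarrow>
     (\<forall>t\<ge>0. Q t \<in> L \<and>
        (\<forall>\<epsilon>>0. \<exists>\<delta>>0. \<forall>n s.
           s 0 = 0 \<and> s n = t \<and> (\<forall>k<n. s k \<le> s (Suc k) \<and> s (Suc k) - s k < \<delta>) \<longrightarrow>
           E (\<lambda>\<omega>. \<bar>(\<Sum>k<n. (X (s (Suc k)) \<omega> - X (s k) \<omega>)\<^sup>2) - Q t \<omega>\<bar>) < \<epsilon>))"

definition diag_matrix :: "('d \<Rightarrow> real) \<Rightarrow> real^'d^'d::finite" where
  "diag_matrix g = (\<chi> i j. if i = j then g i else 0)"

text \<open>
  A set \<open>\<Gamma>\<close> enters only through $G^*$, that is, through the support function of
  $\{\gamma\gamma^T : \gamma\in\Gamma\}$, and therefore represents the variance uncertainty only up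
  to the convex hull of this set: for instance \<open>{1}\<close>, \<open>{-1}\<close> and \<open>{-1, 1}\<close> all give
  the one-dimensional standard Brownian motion. Two sets \<open>\<Gamma>\<close> are the same as sets of variance
  uncertainty iff these hulls (the sets of covariance matrices) coincide.
\<close>
definition covariances :: "(real^'d^'d) set \<Rightarrow> (real^'d^'d::finite) set" where
  "covariances \<Gamma> = convex hull ((\<lambda>\<gamma>. \<gamma> ** transpose \<gamma>) ` \<Gamma>)"

end

theory Submission
  imports Defs "HOL-Real_Asymp.Real_Asymp"
begin

text \<open>
  Testing the equation for quadratic initial data shows that $E[c B^i_t B^j_t] = t \sup_C c\,C_{ij}$,
  where $C$ ranges over $\{\gamma\gamma^T : \gamma\in\Gamma\}$, and additivity over independent increments
  identifies the bounds of $\langle B^i\rangle_1$ with the extreme values of $C_{ii}$.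
  Independence of $B^j$ from $B^i$ makes $E[c B^i_1 B^j_1]$ vanish, so every $C$ is diagonal.

  Box-shaped two-dimensional projections would not give a full box of diagonals when $d \ge 3$, but pairwise
  independence of the processes is far more
  restrictive than that: together with the independence of the increments of $B$ from the past it
  makes $B^j_1$ and $B^i_2 - B^i_1$ independent of each other in both directions. This forces
  one of the two components to vanish unless both have no variance uncertainty. Hence the box of
  diagonals is a point or a segment, and it agrees with the convex hull of the covariances.
  The function $G^*$ is then the support function of the box, which gives the equation in (i).
\<close>

text \<open>The viscosity property can be tested only with bounded functions, while the data that
  reveal moments are polynomials. For the datum \<open>c * x $ i * x $ j\<close> the value function
  is the datum plus a function of time alone. Comparison therefore becomes a one-dimensional problem
  in time, and in space it is enough to dominate a polynomial near one point by a bounded function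
  with a prescribed second-order jet.

  That planar projections do not determine a box is seen from the tetrahedron on the even-parity
  vertices of a cube of diagonals: it projects onto a full square in every pair of coordinates. A
  third-order moment excludes such sets. Let Y be centred and Z have uncertain variance, and
  consider the expectation of the product of Y and the square of Z. If Y is frozen first, the worst
  variance of Z is chosen knowing the sign of Y, which leaves a multiple of the mean of |Y|. If Z is
  frozen first, the centred Y gives zero.\<close>

section \<open>Functions of polynomially growing Lipschitz constant\<close>

text \<open>The point \<open>z\<close> plays the role of the origin: function spaces carry no \<open>0\<close> in the class hierarchy.\<close>
definition lip_gauge :: "('a::minus \<Rightarrow> real) \<Rightarrow> bool" where
  "lip_gauge N \<longleftrightarrow> (\<forall>x. 0 \<le> N x) \<and> (\<exists>z. N z = 0 \<and> (\<forall>x. N (x - z) = N x))"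

text \<open>A power of a quantity that is at least 1 grows with the exponent, and such powers
  multiply, so estimates with different \<open>k\<close> can be brought to a common exponent.
  Closure under sums and products rests on this form.\<close>

lemma C_lLip_iff:
  assumes N: "\<And>x. 0 \<le> N x"
  shows "\<phi> \<in> C_lLip N \<longleftrightarrow>
    (\<exists>C>0. \<exists>k::nat. \<forall>x y. \<bar>\<phi> x - \<phi> y\<bar> \<le> C * max 1 (max (N x) (N y)) ^ k * N (x - y))"
proof
  assume "\<phi> \<in> C_lLip N"
  then obtain C k where C: "C > 0"
    and le: "\<And>x y. \<bar>\<phi> x - \<phi> y\<bar> \<le> C * (1 + N x ^ k + N y ^ k) * N (x - y)"
    unfolding C_lLip_def by blast
  have "\<bar>\<phi> x - \<phi> y\<bar> \<le> (3 * C) * max 1 (max (N x) (N y)) ^ k * N (x - y)" for x y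
  proof -
    let ?M = "max 1 (max (N x) (N y))"
    have "N x ^ k \<le> ?M ^ k" "N y ^ k \<le> ?M ^ k" "1 \<le> ?M ^ k"
      by (auto intro!: power_mono N one_le_power)
    then have "1 + N x ^ k + N y ^ k \<le> 3 * ?M ^ k" by linarith
    then have "C * (1 + N x ^ k + N y ^ k) * N (x - y) \<le> C * (3 * ?M ^ k) * N (x - y)"
      using C N by (intro mult_right_mono mult_left_mono) auto
    then show ?thesis using le[of x y] by (simp add: mult_ac)
  qed
  then show "\<exists>C>0. \<exists>k. \<forall>x y. \<bar>\<phi> x - \<phi> y\<bar> \<le> C * max 1 (max (N x) (N y)) ^ k * N (x - y)"
    using C by (intro exI[of _ "3 * C"]) auto
next
  assume "\<exists>C>0. \<exists>k. \<forall>x y. \<bar>\<phi> x - \<phi> y\<bar> \<le> C * max 1 (max (N x) (N y)) ^ k * N (x - y)"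
  then obtain C k where C: "C > 0"
    and le: "\<And>x y. \<bar>\<phi> x - \<phi> y\<bar> \<le> C * max 1 (max (N x) (N y)) ^ k * N (x - y)" by blast
  have "\<bar>\<phi> x - \<phi> y\<bar> \<le> C * (1 + N x ^ k + N y ^ k) * N (x - y)" for x y
  proof -
    have "max 1 (max (N x) (N y)) ^ k \<le> 1 + N x ^ k + N y ^ k"
      using N by (auto simp: max_def)
    then have "C * max 1 (max (N x) (N y)) ^ k * N (x - y) \<le> C * (1 + N x ^ k + N y ^ k) * N (x - y)"
      using C N by (intro mult_right_mono mult_left_mono) auto
    then show ?thesis using le[of x y] by linarith
  qed
  then show "\<phi> \<in> C_lLip N" unfolding C_lLip_def using C by auto
qed

lemma C_lLip_Lipschitz:
  assumes "\<And>x. 0 \<le> N x" and "\<And>x y. \<bar>\<phi> x - \<phi> y\<bar> \<le> N (x - y)"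
  shows "\<phi> \<in> C_lLip N"
  using assms unfolding C_lLip_iff[OF assms(1)]
  by (intro exI[of _ 1] conjI exI[of _ 0]) auto

lemma C_lLip_const: "(\<And>x. 0 \<le> N x) \<Longrightarrow> (\<lambda>_. c) \<in> C_lLip N"
  by (intro C_lLip_Lipschitz) auto

lemma C_lLip_add:
  assumes N: "\<And>x. 0 \<le> N x" and "\<phi> \<in> C_lLip N" "\<psi> \<in> C_lLip N"
  shows "(\<lambda>x. \<phi> x + \<psi> x) \<in> C_lLip N"
proof -
  let ?M = "\<lambda>x y. max 1 (max (N x) (N y))"
  obtain C k D l where C: "C > 0" "D > 0"
    and le: "\<And>x y. \<bar>\<phi> x - \<phi> y\<bar> \<le> C * ?M x y ^ k * N (x - y)"
      "\<And>x y. \<bar>\<psi> x - \<psi> y\<bar> \<le> D * ?M x y ^ l * N (x - y)"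
    using assms unfolding C_lLip_iff[OF N] by metis
  have "\<bar>(\<phi> x + \<psi> x) - (\<phi> y + \<psi> y)\<bar> \<le> (C + D) * ?M x y ^ (k + l) * N (x - y)" for x y
  proof -
    have "?M x y ^ k \<le> ?M x y ^ (k + l)" "?M x y ^ l \<le> ?M x y ^ (k + l)"
      by (intro power_increasing; simp)+
    then have "C * ?M x y ^ k * N (x - y) \<le> C * ?M x y ^ (k + l) * N (x - y)"
      "D * ?M x y ^ l * N (x - y) \<le> D * ?M x y ^ (k + l) * N (x - y)"
      using C N by (intro mult_right_mono mult_left_mono; simp)+
    then show ?thesis using le(1)[of x y] le(2)[of x y] unfolding distrib_right by linarith
  qed
  then show ?thesis unfolding C_lLip_iff[OF N] using C add_pos_pos by blast
qed

lemma C_lLip_mult: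
  assumes N: "lip_gauge N" and \<phi>: "\<phi> \<in> C_lLip N" and \<psi>: "\<psi> \<in> C_lLip N"
  shows "(\<lambda>x. \<phi> x * \<psi> x) \<in> C_lLip N"
proof -
  let ?M = "\<lambda>x y. max 1 (max (N x) (N y))"
  have N0: "\<And>x. 0 \<le> N x" using N by (auto simp: lip_gauge_def)
  obtain z where z: "N z = 0" "\<And>x. N (x - z) = N x" using N by (auto simp: lip_gauge_def)
  have ex: "\<exists>C>0. \<exists>k. (\<forall>x y. \<bar>f x - f y\<bar> \<le> C * ?M x y ^ k * N (x - y)) \<and>
      (\<forall>x y. \<bar>f x\<bar> \<le> C * ?M x y ^ Suc k \<and> \<bar>f y\<bar> \<le> C * ?M x y ^ Suc k)" if f: "f \<in> C_lLip N" for f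
  proof -
    obtain C k where C: "C > 0" and le: "\<And>x y. \<bar>f x - f y\<bar> \<le> C * ?M x y ^ k * N (x - y)"
      using f unfolding C_lLip_iff[OF N0] by metis
    \<comment> \<open>Comparison with the origin \<open>z\<close> bounds the growth of
      \<open>f\<close>. Enlarging \<open>C\<close> by \<open>|f z|\<close> lets one constant serve
      both the Lipschitz and the growth estimate.\<close>
    let ?C = "\<bar>f z\<bar> + C"
    have "\<bar>f x - f y\<bar> \<le> ?C * ?M x y ^ k * N (x - y)" for x y
    proof -
      have "C * ?M x y ^ k * N (x - y) \<le> ?C * ?M x y ^ k * N (x - y)"
        using N0 by (intro mult_right_mono) auto
      then show ?thesis using le[of x y] by linarith
    qed
    moreover have "\<bar>f x\<bar> \<le> ?C * m ^ Suc k" if m: "1 \<le> m" "N x \<le> m" for x m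
    proof -
      have "C * ?M x z ^ k * N (x - z) \<le> C * m ^ k * m"
        using C N0[of x] m by (intro mult_mono power_mono) (auto simp: z)
      moreover have "\<bar>f z\<bar> * 1 \<le> \<bar>f z\<bar> * m ^ Suc k"
        using m by (intro mult_left_mono one_le_power) auto
      ultimately show ?thesis using le[of x z] by (simp add: algebra_simps)
    qed
    then have "\<forall>x y. \<bar>f x\<bar> \<le> ?C * ?M x y ^ Suc k \<and> \<bar>f y\<bar> \<le> ?C * ?M x y ^ Suc k" by auto
    moreover have "?C > 0" using C by auto
    ultimately show ?thesis by blast
  qed
  obtain C k where C: "C > 0" and f1: "\<And>x y. \<bar>\<phi> x - \<phi> y\<bar> \<le> C * ?M x y ^ k * N (x - y)"
    and f2: "\<And>x y. \<bar>\<phi> x\<bar> \<le> C * ?M x y ^ Suc k"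
    using ex[OF \<phi>] by blast
  obtain D l where D: "D > 0" and g1: "\<And>x y. \<bar>\<psi> x - \<psi> y\<bar> \<le> D * ?M x y ^ l * N (x - y)"
    and g2: "\<And>x y. \<bar>\<psi> y\<bar> \<le> D * ?M x y ^ Suc l"
    using ex[OF \<psi>] by blast
  have "\<bar>\<phi> x * \<psi> x - \<phi> y * \<psi> y\<bar> \<le> (2 * C * D) * ?M x y ^ Suc (k + l) * N (x - y)" for x y
  proof -
    have "\<bar>\<phi> x * \<psi> x - \<phi> y * \<psi> y\<bar> = \<bar>\<phi> x * (\<psi> x - \<psi> y) + \<psi> y * (\<phi> x - \<phi> y)\<bar>"
      by (simp add: algebra_simps)
    also have "\<dots> \<le> \<bar>\<phi> x\<bar> * \<bar>\<psi> x - \<psi> y\<bar> + \<bar>\<psi> y\<bar> * \<bar>\<phi> x - \<phi> y\<bar>"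
      by (metis abs_mult abs_triangle_ineq)
    also have "\<dots> \<le> (C * ?M x y ^ Suc k) * (D * ?M x y ^ l * N (x - y)) +
        (D * ?M x y ^ Suc l) * (C * ?M x y ^ k * N (x - y))"
      using C D f1 f2 g1 g2 by (intro add_mono mult_mono) auto
    also have "\<dots> = (2 * C * D) * ?M x y ^ Suc (k + l) * N (x - y)"
      by (simp add: power_add algebra_simps)
    finally show ?thesis .
  qed
  moreover have "2 * C * D > 0" using C D by simp
  ultimately show ?thesis unfolding C_lLip_iff[OF N0] by blast
qed

lemma C_lLip_sum:
  assumes "\<And>x. 0 \<le> N x" and "\<And>a. a \<in> A \<Longrightarrow> f a \<in> C_lLip N"
  shows "(\<lambda>x. \<Sum>a\<in>A. f a x) \<in> C_lLip N"
  using assms(2) by (induction A rule: infinite_finite_induct) (auto intro: C_lLip_const C_lLip_add assms(1))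

lemma C_lLip_power:
  assumes "lip_gauge N" and "\<phi> \<in> C_lLip N"
  shows "(\<lambda>x. \<phi> x ^ n) \<in> C_lLip N"
proof (induction n)
  case 0
  show ?case using assms(1) by (simp add: C_lLip_const lip_gauge_def)
next
  case (Suc n)
  then show ?case using C_lLip_mult[OF assms] by simp
qed

lemma C_lLip_cmult:
  assumes "lip_gauge N" and "\<phi> \<in> C_lLip N"
  shows "(\<lambda>x. c * \<phi> x) \<in> C_lLip N"
  using assms by (intro C_lLip_mult C_lLip_const) (auto simp: lip_gauge_def)

lemma C_lLip_diff:
  assumes N: "lip_gauge N" and "\<phi> \<in> C_lLip N" "\<psi> \<in> C_lLip N"
  shows "(\<lambda>x. \<phi> x - \<psi> x) \<in> C_lLip N"
  using C_lLip_add[OF _ assms(2) C_lLip_cmult[OF N assms(3), of "-1"]] N by (simp add: lip_gauge_def)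

lemma lip_gauge_norm: "lip_gauge (norm :: 'a::real_normed_vector \<Rightarrow> real)"
  unfolding lip_gauge_def by (intro conjI exI[of _ 0]) auto

lemma lip_gauge_vec_norm: "lip_gauge (vec_norm n)"
  unfolding lip_gauge_def vec_norm_def
  by (intro conjI exI[of _ "\<lambda>_. 0"]) (auto simp: L2_set_def fun_diff_def sum_nonneg)

lemma lip_gauge_pair_norm: "lip_gauge (pair_norm m n)"
proof -
  obtain x y where "vec_norm m x = 0" "\<And>u. vec_norm m (u - x) = vec_norm m (u :: nat \<Rightarrow> 'a)"
    "vec_norm n y = 0" "\<And>u. vec_norm n (u - y) = vec_norm n (u :: nat \<Rightarrow> 'b)"
    using lip_gauge_vec_norm unfolding lip_gauge_def by metis
  then show ?thesis unfolding lip_gauge_def pair_norm_def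
    by (intro conjI exI[of _ "(x, y)"]) auto
qed

lemma lip_gauge_nonneg: "lip_gauge N \<Longrightarrow> 0 \<le> N x"
  by (simp add: lip_gauge_def)

lemma vec_norm_nonneg: "0 \<le> vec_norm n x"
  by (rule lip_gauge_nonneg[OF lip_gauge_vec_norm])

lemma norm_le_vec_norm: "k < n \<Longrightarrow> norm (x k) \<le> vec_norm n x"
  unfolding vec_norm_def by (intro member_le_L2_set) auto

lemma pair_norm_ge: "vec_norm m (fst p) \<le> pair_norm m n p" "vec_norm n (snd p) \<le> pair_norm m n p"
  unfolding pair_norm_def using vec_norm_nonneg by (auto simp: case_prod_beta intro!: real_le_rsqrt)

lemma C_lLip_nth: "(\<lambda>x. x $ i) \<in> C_lLip (norm :: real^'d::finite \<Rightarrow> real)"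
  by (intro C_lLip_Lipschitz) (auto simp flip: vector_minus_component intro: component_le_norm_cart)

lemma C_lLip_vec_coord:
  assumes "k < n" and "\<And>a b. \<bar>g a - g b\<bar> \<le> norm (a - b)"
  shows "(\<lambda>x. g (x k)) \<in> C_lLip (vec_norm n)"
proof (intro C_lLip_Lipschitz)
  fix x y :: "nat \<Rightarrow> 'a"
  have "\<bar>g (x k) - g (y k)\<bar> \<le> norm ((x - y) k)" using assms(2) by (simp add: fun_diff_def)
  also have "\<dots> \<le> vec_norm n (x - y)" by (rule norm_le_vec_norm[OF assms(1)])
  finally show "\<bar>g (x k) - g (y k)\<bar> \<le> vec_norm n (x - y)" .
qed (rule vec_norm_nonneg)

text \<open>The map \<open>g\<close> is kept general because two cases occur: a coordinate, when the
  process is vector valued, and the identity, when single components of \<open>B\<close> are the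
  processes.\<close>

lemma C_lLip_pair_fst:
  assumes "k < m" and g: "\<And>a b. \<bar>g a - g b\<bar> \<le> norm (a - b)"
  shows "(\<lambda>p. g (fst p k)) \<in> C_lLip (pair_norm m n)"
proof (intro C_lLip_Lipschitz)
  fix p q :: "(nat \<Rightarrow> 'a) \<times> (nat \<Rightarrow> 'b)"
  have "\<bar>g (fst p k) - g (fst q k)\<bar> \<le> norm (fst (p - q) k)" using g by simp
  also have "\<dots> \<le> pair_norm m n (p - q)"
    by (rule order_trans[OF norm_le_vec_norm[OF assms(1)] pair_norm_ge(1)])
  finally show "\<bar>g (fst p k) - g (fst q k)\<bar> \<le> pair_norm m n (p - q)" .
qed (rule lip_gauge_nonneg[OF lip_gauge_pair_norm])

lemma C_lLip_pair_snd:
  assumes "k < n" and g: "\<And>a b. \<bar>g a - g b\<bar> \<le> norm (a - b)"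
  shows "(\<lambda>p. g (snd p k)) \<in> C_lLip (pair_norm m n)"
proof (intro C_lLip_Lipschitz)
  fix p q :: "(nat \<Rightarrow> 'b) \<times> (nat \<Rightarrow> 'a)"
  have "\<bar>g (snd p k) - g (snd q k)\<bar> \<le> norm (snd (p - q) k)" using g by simp
  also have "\<dots> \<le> pair_norm m n (p - q)"
    by (rule order_trans[OF norm_le_vec_norm[OF assms(1)] pair_norm_ge(2)])
  finally show "\<bar>g (snd p k) - g (snd q k)\<bar> \<le> pair_norm m n (p - q)" .
qed (rule lip_gauge_nonneg[OF lip_gauge_pair_norm])

lemma abs_nth_diff_le_norm: "\<bar>x $ i - y $ i\<bar> \<le> norm (x - y)" for x y :: "real^'d::finite"
  by (metis component_le_norm_cart vector_minus_component)

section \<open>Viscosity solutions with quadratic spatial part\<close>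

lemma eventually_nhds_0_from_right:
  fixes P :: "real \<Rightarrow> bool"
  assumes "P 0" "eventually P (at_right 0)" "eventually (\<lambda>z. P (- z)) (at_right 0)"
  shows "eventually P (nhds 0)"
  using assms eventually_at_left_to_right[of P 0]
  by (simp add: eventually_nhds_conv_at eventually_at_split)

text \<open>The square of sin z is z^2 - z^4/3 + ..., so adding its fourth power overshoots z^2 when
  \<open>a\<close> is positive; when \<open>a\<close> is negative, |sin z| \<le> |z| already gives
  the inequality. The correction is of order four and leaves the 2-jet alone.\<close>

lemma eventually_sq_le_sin:
  "\<forall>\<^sub>F z in nhds 0. a * z\<^sup>2 \<le> a * (sin z)\<^sup>2 + \<bar>a\<bar> * sin z ^ 4" for a :: real
proof -
  have r: "\<forall>\<^sub>F z::real in at_right 0. z\<^sup>2 \<le> (sin z)\<^sup>2 + sin z ^ 4" by real_asymp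
  have "\<forall>\<^sub>F z::real in nhds 0. z\<^sup>2 \<le> (sin z)\<^sup>2 + sin z ^ 4"
    by (rule eventually_nhds_0_from_right) (use r in auto)
  then show ?thesis
  proof eventually_elim
    case (elim z)
    have "(sin z)\<^sup>2 \<le> z\<^sup>2" using abs_sin_x_le_abs_x[of z] by (simp add: abs_le_square_iff)
    then show ?case
    proof (cases "a \<ge> 0")
      case True
      then show ?thesis using mult_left_mono[OF elim True] by (simp add: distrib_left)
    next
      case False
      then have "a * z\<^sup>2 \<le> a * (sin z)\<^sup>2" using \<open>(sin z)\<^sup>2 \<le> z\<^sup>2\<close> by (intro mult_left_mono_neg) auto
      moreover have "0 \<le> \<bar>a\<bar> * sin z ^ 4" by simp
      ultimately show ?thesis by linarith
    qed
  qed
qed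

text \<open>The error z - sin z is odd of order three, so no fourth-order term dominates it on both
  sides of 0. A second-order term does, at the price of a second derivative that is made small
  through \<open>\<epsilon>\<close>.\<close>

lemma eventually_linear_le_sin:
  fixes e \<epsilon> :: real
  assumes "\<epsilon> > 0"
  shows "\<forall>\<^sub>F z in nhds 0. e * z \<le> e * sin z + \<epsilon> * (sin z)\<^sup>2"
proof -
  \<comment> \<open>The summand 1 keeps the quotient meaningful for \<open>e = 0\<close>.\<close>
  define c where "c = \<epsilon> / (\<bar>e\<bar> + 1)"
  have c: "c > 0" using assms by (simp add: c_def)
  have "\<forall>\<^sub>F z in at_right 0. z \<le> sin z + c * (sin z)\<^sup>2" "\<forall>\<^sub>F z in at_right 0. sin z \<le> z + c * (sin z)\<^sup>2"
    using c by real_asymp+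
  then have r: "\<forall>\<^sub>F z in at_right 0. \<bar>z - sin z\<bar> \<le> c * (sin z)\<^sup>2"
    by eventually_elim (auto simp: abs_if)
  have "\<forall>\<^sub>F z in nhds 0. \<bar>z - sin z\<bar> \<le> c * (sin z)\<^sup>2"
    by (rule eventually_nhds_0_from_right) (use r in \<open>auto simp: abs_minus_commute add.commute\<close>)
  then show ?thesis
  proof eventually_elim
    case (elim z)
    have "e * (z - sin z) \<le> \<bar>e\<bar> * \<bar>z - sin z\<bar>" by (metis abs_ge_self abs_mult)
    also have "\<dots> \<le> (\<bar>e\<bar> + 1) * (c * (sin z)\<^sup>2)" using elim by (intro mult_mono) auto
    also have "\<dots> = \<epsilon> * (sin z)\<^sup>2" by (simp add: c_def field_simps)
    finally show ?case by (simp add: algebra_simps)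
  qed
qed

section \<open>Trigonometric test functions\<close>

definition trig :: "(real \<times> (real^'d::finite) \<times> real) list \<Rightarrow> real^'d \<Rightarrow> real" where
  "trig ps y = (\<Sum>(c, v, \<theta>)\<leftarrow>ps. c * cos (v \<bullet> y + \<theta>))"

text \<open>Differentiating a cosine shifts its phase by pi/2 and multiplies its amplitude by a
  frequency. On lists this is a plain map, so iterated partial derivatives stay in the class, and
  continuity and boundedness of all of them follow from one statement about
  \<open>trig\<close>.\<close>

definition trig_deriv ::
  "'d::finite \<Rightarrow> (real \<times> (real^'d) \<times> real) list \<Rightarrow> (real \<times> (real^'d) \<times> real) list" where
  "trig_deriv i = map (\<lambda>(c, v, \<theta>). (c * v $ i, v, \<theta> + pi / 2))"

lemma has_derivative_trig:
  "((\<lambda>h. trig ps (x + h *\<^sub>R axis i 1)) has_real_derivative trig (trig_deriv i ps) x) (at 0)"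
proof (induction ps)
  case Nil
  then show ?case by (simp add: trig_def trig_deriv_def)
next
  case (Cons p ps)
  obtain c v \<theta> where p: "p = (c, v, \<theta>)" by (metis prod_cases3)
  have "((\<lambda>h. c * cos (v \<bullet> (x + h *\<^sub>R axis i 1) + \<theta>)) has_real_derivative
      c * v $ i * cos (v \<bullet> x + \<theta> + pi / 2)) (at 0)"
    by (auto intro!: derivative_eq_intros simp: inner_add_right inner_axis cos_add[of _ "pi / 2"])
  from DERIV_add[OF this Cons.IH] show ?case
    by (simp add: p trig_def trig_deriv_def algebra_simps)
qed

lemma partial_const_trig:
  "partial i (\<lambda>y. \<alpha> + trig ps y) = trig (trig_deriv i ps)"
  unfolding partial_def
  by (intro ext DERIV_imp_deriv DERIV_add[OF DERIV_const has_derivative_trig, simplified])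

lemma foldr_partial_trig:
  "foldr partial js (\<lambda>y. \<alpha> + trig ps y) =
     (\<lambda>y. (if js = [] then \<alpha> else 0) + trig (foldr trig_deriv js ps) y)"
  by (induction js) (auto simp: partial_const_trig)

lemma continuous_trig [continuous_intros]:
  fixes g :: "'a::t2_space \<Rightarrow> real^'d::finite"
  shows "continuous_on S g \<Longrightarrow> continuous_on S (\<lambda>z. trig ps (g z))"
  unfolding trig_def
  by (induction ps) (auto intro!: continuous_intros)

lemma abs_trig_le: "\<bar>trig ps y\<bar> \<le> (\<Sum>(c, v, \<theta>)\<leftarrow>ps. \<bar>c\<bar>)"
proof (induction ps)
  case (Cons p ps)
  obtain c v \<theta> where p: "p = (c, v, \<theta>)" by (metis prod_cases3)
  have "\<bar>c * cos (v \<bullet> y + \<theta>)\<bar> \<le> \<bar>c\<bar>" by (simp add: abs_mult mult_left_le)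
  then show ?case using Cons.IH by (simp add: p trig_def)
qed (simp add: trig_def)

lemma trig_in_C_b13:
  assumes a: "\<And>s. (a has_real_derivative a' s) (at s)" "continuous_on UNIV a'"
    and bd: "\<And>s. \<bar>a s\<bar> \<le> K" "\<And>s. \<bar>a' s\<bar> \<le> K"
  shows "(\<lambda>s y. a s + trig ps y) \<in> C_b13"
proof -
  have cont: "continuous_on UNIV a" using a(1) by (meson DERIV_isCont continuous_at_imp_continuous_on)
  have dt: "deriv (\<lambda>s. a s + trig ps y) s = a' s" for s y
    using a(1) by (auto intro!: DERIV_imp_deriv derivative_eq_intros)
  have "(\<lambda>h. foldr partial js (\<lambda>y. a s + trig ps y) (x + h *\<^sub>R axis i 1)) differentiable (at 0)"
    for js i s x
    unfolding foldr_partial_trig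
    using DERIV_add[OF DERIV_const has_derivative_trig[of "foldr trig_deriv js ps" x i]]
    unfolding real_differentiable_def by blast
  moreover have "continuous_on ({0<..} \<times> UNIV) (\<lambda>(s, x). foldr partial js (\<lambda>y. a s + trig ps y) x)"
    for js unfolding foldr_partial_trig case_prod_beta
    by (cases "js = []") (auto intro!: continuous_intros continuous_on_compose2[OF cont])
  moreover have "bounded ((\<lambda>(s, x). foldr partial js (\<lambda>y. a s + trig ps y) x) ` ({0<..} \<times> UNIV))"
    for js
  proof -
    let ?S = "\<Sum>(c, v, \<theta>)\<leftarrow>foldr trig_deriv js ps. \<bar>c\<bar>"
    have "\<bar>foldr partial js (\<lambda>y. a s + trig ps y) x\<bar> \<le> K + ?S" for s x
      unfolding foldr_partial_trig
      using abs_trig_le[of "foldr trig_deriv js ps" x] bd(1)[of s]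
      by (auto intro: order_trans[OF abs_triangle_ineq])
    then show ?thesis by (auto simp: bounded_iff)
  qed
  moreover have "(\<lambda>s. a s + trig ps y) differentiable (at s)" for s y
    using a(1)[of s] by (auto intro!: derivative_intros simp: real_differentiable_def)
  moreover have "continuous_on ({0<..} \<times> UNIV) (\<lambda>(s, x). deriv (\<lambda>s. a s + trig ps x) s)"
    unfolding dt case_prod_beta by (auto intro!: continuous_intros continuous_on_compose2[OF a(2)])
  moreover have "bounded ((\<lambda>(s, x). deriv (\<lambda>s. a s + trig ps x) s) ` ({0<..} \<times> UNIV))"
    unfolding dt using bd(2) by (auto simp: bounded_iff)
  ultimately show ?thesis unfolding C_b13_def by blast
qed

text \<open>The Hessian of the quadratic form \<open>a * (v \<bullet> y)\<^sup>2 + b * (w \<bullet>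
  y)\<^sup>2 + \<epsilon> * (q \<bullet> y)\<^sup>2\<close>. Two free squares suffice for products
  of coordinates by polarisation; the third is the trace left by a linear term.\<close>

definition quad_hess ::
  "real \<Rightarrow> real^'d \<Rightarrow> real \<Rightarrow> real^'d \<Rightarrow> real \<Rightarrow> real^'d \<Rightarrow> real^'d^'d::finite" where
  "quad_hess a v b w \<epsilon> q =
     (\<chi> i j. 2 * (a * v $ i * v $ j + b * w $ i * w $ j + \<epsilon> * q $ i * q $ j))"

text \<open>Bounded functions of \<open>z = v \<bullet> y\<close> with the 2-jet of \<open>a * z\<^sup>2\<close>, resp. of \<open>e * z\<close> up to
  \<open>\<epsilon>\<close>, that dominate it near \<open>0\<close>: they stand in for the polynomials, which are not in \<open>C_b13\<close>.\<close>
definition trig_sq :: "real \<Rightarrow> real^'d::finite \<Rightarrow> (real \<times> (real^'d) \<times> real) list" where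
  "trig_sq a v = [(a / 2 + 3 * \<bar>a\<bar> / 8, 0, 0), (- (a + \<bar>a\<bar>) / 2, 2 *\<^sub>R v, 0), (\<bar>a\<bar> / 8, 4 *\<^sub>R v, 0)]"

definition trig_linear :: "real \<Rightarrow> real \<Rightarrow> real^'d::finite \<Rightarrow> (real \<times> (real^'d) \<times> real) list" where
  "trig_linear e \<epsilon> q = [(e, q, - pi / 2), (\<epsilon> / 2, 0, 0), (- \<epsilon> / 2, 2 *\<^sub>R q, 0)]"

lemma trig_append: "trig (ps @ qs) y = trig ps y + trig qs y"
  by (simp add: trig_def)

text \<open>The coefficients in \<open>trig_sq\<close> come from power reduction: sin^2 z = (1 - cos
  2z)/2 and sin^4 z = (3 - 4 cos 2z + cos 4z)/8.\<close>

lemma trig_trig_sq: "trig (trig_sq a v) y = a * (sin (v \<bullet> y))\<^sup>2 + \<bar>a\<bar> * sin (v \<bullet> y) ^ 4"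
proof -
  let ?s = "(sin (v \<bullet> y))\<^sup>2"
  have c2: "cos (2 * (v \<bullet> y)) = 1 - 2 * ?s" by (simp add: cos_double_sin)
  have "cos (4 * (v \<bullet> y)) = 2 * (cos (2 * (v \<bullet> y)))\<^sup>2 - 1"
    using cos_double_cos[of "2 * (v \<bullet> y)"] by simp
  then have c4: "cos (4 * (v \<bullet> y)) = 2 * (1 - 2 * ?s)\<^sup>2 - 1" by (simp add: c2)
  have s4: "sin (v \<bullet> y) ^ 4 = ?s\<^sup>2" by (simp flip: power_mult)
  have "trig (trig_sq a v) y = (a / 2 + 3 * \<bar>a\<bar> / 8) - (a + \<bar>a\<bar>) / 2 * cos (2 * (v \<bullet> y))
      + \<bar>a\<bar> / 8 * cos (4 * (v \<bullet> y))" by (simp add: trig_def trig_sq_def field_simps)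
  then show ?thesis unfolding c2 c4 s4 by (simp add: power2_eq_square field_simps)
qed

lemma trig_trig_linear:
  "trig (trig_linear e \<epsilon> q) y = e * sin (q \<bullet> y) + \<epsilon> * (sin (q \<bullet> y))\<^sup>2"
proof -
  have "\<epsilon> / 2 - \<epsilon> / 2 * cos (2 * (q \<bullet> y)) = \<epsilon> * (sin (q \<bullet> y))\<^sup>2"
    unfolding cos_double_sin by (simp add: algebra_simps)
  moreover have "cos (q \<bullet> y + - pi / 2) = sin (q \<bullet> y)" by (simp add: cos_diff)
  ultimately show ?thesis by (simp add: trig_def trig_linear_def)
qed

lemma hessian_const_trig:
  "hessian (\<lambda>y. \<alpha> + trig ps y) x = (\<chi> i j. trig (trig_deriv i (trig_deriv j ps)) x)"
  unfolding hessian_def partial_const_trig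
  by (simp add: partial_const_trig[where \<alpha> = 0, simplified])

text \<open>At the origin the second derivatives of sin and of its fourth power vanish, so only the
  squared sines contribute.\<close>

lemma hessian_trig_quad:
  "hessian (\<lambda>y. \<alpha> + trig (trig_sq a v @ trig_sq b w @ trig_linear e \<epsilon> q) y) 0 = quad_hess a v b w \<epsilon> q"
  unfolding hessian_const_trig quad_hess_def
  by (simp add: vec_eq_iff trig_def trig_deriv_def trig_sq_def trig_linear_def cos_add sin_add field_simps)

section \<open>Comparison in time for data quadratic in space\<close>

lemma eventually_inner_nhds_0:
  fixes v :: "real^'d::finite"
  assumes "\<forall>\<^sub>F z in nhds 0. P z"
  shows "\<forall>\<^sub>F y in nhds 0. P (v \<bullet> y)"
proof (rule eventually_compose_filterlim[OF assms])
  have "((\<lambda>y. v \<bullet> y) \<longlongrightarrow> v \<bullet> 0) (nhds 0)" by (intro tendsto_intros filterlim_ident)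
  then show "filterlim (\<lambda>y. v \<bullet> y) (nhds 0) (nhds 0)" by simp
qed

lemmas viscosity_solutionD = viscosity_solution_def[THEN iffD1, THEN conjunct2, THEN conjunct2,
    THEN bspec, THEN spec, THEN mp, THEN spec]

text \<open>Both \<open>u\<close> and the test function are sums of a time part and a space part, so
  domination of each part separately yields the local maximum at \<open>(t, 0)\<close>. A parabola
  of slope \<open>p\<close> above \<open>f\<close> is then enough to read off the subsolution
  inequality.\<close>

lemma viscosity_quadratic_jet:
  fixes v w q :: "real^'d::finite"
  assumes vs: "viscosity_solution F \<phi> u" and t: "t > 0" and \<epsilon>: "\<epsilon> > 0"
    and u: "\<And>s y. s \<ge> 0 \<Longrightarrow> u s y = a * (v \<bullet> y)\<^sup>2 + b * (w \<bullet> y)\<^sup>2 + e * (q \<bullet> y) + f s"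
    and f: "\<forall>\<^sub>F s in nhds t. f s \<le> f t + p * (s - t) + M * (s - t)\<^sup>2"
  shows "p \<le> F (quad_hess a v b w \<epsilon> q)"
proof -
  let ?ps = "trig_sq a v @ trig_sq b w @ trig_linear e \<epsilon> q"
  \<comment> \<open>Bounded majorant of the parabola in \<open>s - t\<close>: the first two terms
    dominate the linear part with \<open>\<epsilon>\<close> equal to 1, the last two the quadratic
    part. The extra second-order term is harmless because the equation sees only the first time
    derivative.\<close>
  define A where "A s = p * sin (s - t) + (sin (s - t))\<^sup>2 + M * (sin (s - t))\<^sup>2 + \<bar>M\<bar> * sin (s - t) ^ 4" for s
  define A' where "A' s = p * cos (s - t) + 2 * sin (s - t) * cos (s - t)
    + M * (2 * sin (s - t) * cos (s - t)) + \<bar>M\<bar> * (4 * sin (s - t) ^ 3 * cos (s - t))" for s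
  \<comment> \<open>The four terms of \<open>A'\<close> are at most \<open>|p|\<close>, 2,
    \<open>2 * |M|\<close> and \<open>4 * |M|\<close>; their sum bounds \<open>A\<close> as
    well.\<close>
  define K where "K = \<bar>p\<bar> + 2 + 6 * \<bar>M\<bar>"
  have AD: "(A has_real_derivative A' s) (at s)" for s
    unfolding A_def[abs_def] A'_def by (auto intro!: derivative_eq_intros simp: algebra_simps)
  have le1: "\<bar>x * y\<bar> \<le> \<bar>x\<bar>" if "\<bar>y\<bar> \<le> 1" for x y :: real
    using that by (simp add: abs_mult mult_left_le)
  have pow1: "\<bar>sin z ^ n * cos z ^ m\<bar> \<le> 1" for z :: real and m n
    by (simp add: abs_mult power_abs mult_le_one power_le_one)
  have abs4: "\<bar>x1 + x2 + x3 + x4\<bar> \<le> c1 + c2 + c3 + c4"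
    if "\<bar>x1\<bar> \<le> c1" "\<bar>x2\<bar> \<le> c2" "\<bar>x3\<bar> \<le> c3" "\<bar>x4\<bar> \<le> c4" for x1 x2 x3 x4 c1 c2 c3 c4 :: real
    using that by linarith
  have "\<bar>A s\<bar> \<le> K" for s
    using abs4[OF le1[OF pow1[of "s - t" 1 0], of p] pow1[of "s - t" 2 0]
      le1[OF pow1[of "s - t" 2 0], of M] le1[OF pow1[of "s - t" 4 0], of "\<bar>M\<bar>"]]
    by (simp add: A_def K_def)
  moreover have "A' s = p * (sin (s - t) ^ 0 * cos (s - t) ^ 1) + 2 * (sin (s - t) ^ 1 * cos (s - t) ^ 1)
      + 2 * M * (sin (s - t) ^ 1 * cos (s - t) ^ 1) + 4 * \<bar>M\<bar> * (sin (s - t) ^ 3 * cos (s - t) ^ 1)" for s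
    by (simp add: A'_def)
  then have "\<bar>A' s\<bar> \<le> K" for s
    using abs4[OF le1[OF pow1[of "s - t" 0 1], of p] le1[OF pow1[of "s - t" 1 1], of 2]
      le1[OF pow1[of "s - t" 1 1], of "2 * M"] le1[OF pow1[of "s - t" 3 1], of "4 * \<bar>M\<bar>"]]
    by (simp add: K_def abs_mult)
  moreover have "continuous_on UNIV A'"
    unfolding A'_def[abs_def] by (intro continuous_intros)
  ultimately have mem: "(\<lambda>s y. A s + trig ?ps y) \<in> C_b13"
    by (intro trig_in_C_b13[OF AD])
  have ps0: "trig ?ps 0 = 0" "A t = 0" by (simp_all add: trig_append trig_trig_sq trig_trig_linear A_def)
  have "((\<lambda>s. s - t) \<longlongrightarrow> t - t) (nhds t)" by (intro tendsto_intros) (auto simp: filterlim_ident)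
  then have shift: "filterlim (\<lambda>s. s - t) (nhds 0) (nhds t)" by simp
  have lin: "\<forall>\<^sub>F s in nhds t. p * (s - t) \<le> p * sin (s - t) + 1 * (sin (s - t))\<^sup>2"
    by (rule eventually_compose_filterlim[OF eventually_linear_le_sin shift]) simp
  have sq: "\<forall>\<^sub>F s in nhds t. M * (s - t)\<^sup>2 \<le> M * (sin (s - t))\<^sup>2 + \<bar>M\<bar> * sin (s - t) ^ 4"
    by (rule eventually_compose_filterlim[OF eventually_sq_le_sin shift])
  have pos: "\<forall>\<^sub>F s in nhds t. s > 0"
    using t by (metis eventually_nhds greaterThan_iff open_greaterThan)
  have T: "\<forall>\<^sub>F s in nhds t. s > 0 \<and> f s \<le> f t + A s"
    using lin sq f pos by eventually_elim (simp add: A_def)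
  have "\<forall>\<^sub>F y in nhds 0. a * (v \<bullet> y)\<^sup>2 \<le> a * (sin (v \<bullet> y))\<^sup>2 + \<bar>a\<bar> * sin (v \<bullet> y) ^ 4"
    "\<forall>\<^sub>F y in nhds 0. b * (w \<bullet> y)\<^sup>2 \<le> b * (sin (w \<bullet> y))\<^sup>2 + \<bar>b\<bar> * sin (w \<bullet> y) ^ 4"
    "\<forall>\<^sub>F y in nhds 0. e * (q \<bullet> y) \<le> e * sin (q \<bullet> y) + \<epsilon> * (sin (q \<bullet> y))\<^sup>2"
    by (rule eventually_inner_nhds_0[OF eventually_sq_le_sin]
        eventually_inner_nhds_0[OF eventually_linear_le_sin[OF \<epsilon>]])+
  then have S: "\<forall>\<^sub>F y in nhds 0. a * (v \<bullet> y)\<^sup>2 + b * (w \<bullet> y)\<^sup>2 + e * (q \<bullet> y) \<le> trig ?ps y"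
    by eventually_elim (simp add: trig_append trig_trig_sq trig_trig_linear)
  have "\<forall>\<^sub>F z in nhds t \<times>\<^sub>F nhds 0. (fst z > 0 \<and> f (fst z) \<le> f t + A (fst z)) \<and>
      a * (v \<bullet> snd z)\<^sup>2 + b * (w \<bullet> snd z)\<^sup>2 + e * (q \<bullet> snd z) \<le> trig ?ps (snd z)"
    using eventually_prodI[OF T S] by simp
  then have "\<forall>\<^sub>F z in nhds (t, 0). u (fst z) (snd z) - (A (fst z) + trig ?ps (snd z)) \<le> u t 0 - (A t + trig ?ps 0)"
    unfolding nhds_prod
    by (rule eventually_mono) (use t in \<open>auto simp: u ps0\<close>)
  then have "\<forall>\<^sub>F (s, y) in nhds (t, 0). u s y - (A s + trig ?ps y) \<le> u t 0 - (A t + trig ?ps 0)"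
    by (simp only: case_prod_unfold)
  then have "deriv (\<lambda>s. A s + trig ?ps 0) t - F (hessian (\<lambda>y. A t + trig ?ps y) 0) \<le> 0"
    by (rule viscosity_solutionD[OF vs mem t, THEN conjunct1, THEN mp])
  moreover have "deriv (\<lambda>s. A s + trig ?ps 0) t = p"
    using AD[of t] by (auto intro!: DERIV_imp_deriv derivative_eq_intros simp: A'_def)
  ultimately show ?thesis by (simp add: hessian_trig_quad)
qed

text \<open>If \<open>f T > c * T\<close>, then \<open>k s = (f s - c * s) * (T + 1 - s)\<close> has a positive maximum in the interior,
  where \<open>c * r + k s / (T + 1 - r)\<close> touches \<open>f\<close> from above with a slope exceeding \<open>c\<close>.\<close>
lemma viscosity_quadratic_le:
  fixes v w q :: "real^'d::finite"
  assumes vs: "viscosity_solution F \<phi> u" and \<epsilon>: "\<epsilon> > 0"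
    and u: "\<And>s y. s \<ge> 0 \<Longrightarrow> u s y = a * (v \<bullet> y)\<^sup>2 + b * (w \<bullet> y)\<^sup>2 + e * (q \<bullet> y) + f s"
    and f0: "f 0 = 0" and T: "T \<ge> 0"
  shows "f T \<le> T * F (quad_hess a v b w \<epsilon> q)"
proof (rule ccontr)
  define c where "c = F (quad_hess a v b w \<epsilon> q)"
  assume "\<not> f T \<le> T * F (quad_hess a v b w \<epsilon> q)"
  then have big: "f T - c * T > 0" by (simp add: c_def mult.commute)
  with f0 T have "T > 0" by (cases "T = 0") auto
  define k where "k s = (f s - c * s) * (T + 1 - s)" for s
  have "continuous_on {0..} (\<lambda>s. u s 0)"
  proof -
    have "continuous_on ({0..} \<times> UNIV) (\<lambda>(s, y). u s y)" using vs by (simp add: viscosity_solution_def)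
    then have "continuous_on {0..} (\<lambda>s. case (s, 0) of (s, y) \<Rightarrow> u s y)"
      by (rule continuous_on_compose2) (auto intro!: continuous_intros)
    then show ?thesis by simp
  qed
  then have "continuous_on {0..} f" by (rule continuous_on_eq) (simp add: u)
  then have "continuous_on {0..T + 1} k"
    unfolding k_def by (auto intro!: continuous_intros intro: continuous_on_subset)
  then obtain s where s: "s \<in> {0..T + 1}" and max: "\<And>r. r \<in> {0..T + 1} \<Longrightarrow> k r \<le> k s"
    using continuous_attains_sup[of "{0..T + 1}" k] T by auto
  have "k T > 0" using big by (simp add: k_def)
  with max[of T] T have ks: "k s > 0" by auto
  have "s \<noteq> 0" "s \<noteq> T + 1" using ks f0 by (auto simp: k_def)
  with s have s0: "0 < s" and s1: "s < T + 1" by auto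
  define D where "D = T + 1 - s"
  have D: "D > 0" using s1 by (simp add: D_def)
  have fs: "f s = c * s + k s / D" using D by (simp add: k_def D_def field_simps)
  have "\<forall>\<^sub>F r in nhds s. r \<in> {0<..<T + 1} \<inter> {..<s + D / 2}"
    by (rule eventually_nhds_in_open) (use s0 s1 D in auto)
  then have "\<forall>\<^sub>F r in nhds s. f r \<le> f s + (c + k s / D\<^sup>2) * (r - s) + (2 * k s / D ^ 3) * (r - s)\<^sup>2"
  proof eventually_elim
    case (elim r)
    define x where "x = r - s"
    have x: "x < D / 2" "r = s + x" "T + 1 - r = D - x" using elim by (auto simp: x_def D_def field_simps)
    have "k r \<le> k s" using elim by (intro max) auto
    then have "(f r - c * r) * (D - x) \<le> k s" unfolding x(3)[symmetric] by (simp only: k_def)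
    then have "f r - c * r \<le> k s / (D - x)"
      using x D by (simp add: pos_le_divide_eq)
    also have "\<dots> = k s * (1 / (D - x))" by simp
    \<comment> \<open>Taylor expansion of \<open>1 / (D - x)\<close> with the quadratic coefficient
      doubled: the slack absorbs the remainder for positive \<open>x\<close>, as long as
      \<open>x\<close> stays below \<open>D / 2\<close>.\<close>
    also have "\<dots> \<le> k s * (1 / D + x / D\<^sup>2 + 2 * x\<^sup>2 / D ^ 3)"
    proof (intro mult_left_mono)
      have "(1 / D + x / D\<^sup>2 + 2 * x\<^sup>2 / D ^ 3) * (D - x) - 1 = x\<^sup>2 * (D - 2 * x) / D ^ 3"
        using D by (simp add: field_simps power2_eq_square power3_eq_cube)
      also have "\<dots> \<ge> 0" using x D by simp
      finally show "1 / (D - x) \<le> 1 / D + x / D\<^sup>2 + 2 * x\<^sup>2 / D ^ 3"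
        using x D by (simp add: pos_divide_le_eq)
    qed (use ks in simp)
    finally show ?case unfolding fs x_def[symmetric] using x(2) by (simp add: algebra_simps)
  qed
  from viscosity_quadratic_jet[OF vs s0 \<epsilon> u this]
  have "c + k s / D\<^sup>2 \<le> c" by (simp add: c_def)
  moreover have "k s / D\<^sup>2 > 0" using ks D by simp
  ultimately show False by simp
qed

section \<open>Change of sign in the viscosity property\<close>

lemma foldr_partial_uminus:
  assumes "\<psi> \<in> C_b13" "t > 0"
  shows "length js \<le> 3 \<Longrightarrow> foldr partial js (\<lambda>y. - \<psi> t y) = (\<lambda>y. - foldr partial js (\<psi> t) y)"
proof (induction js)
  case (Cons j js)
  \<comment> \<open>The value of \<open>deriv\<close> at a point of non-differentiability is
    arbitrary and need not change sign with the function; the differentiability recorded in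
    \<open>C_b13\<close> makes negation pass through.\<close>
  have "(\<lambda>h. foldr partial js (\<psi> t) (x + h *\<^sub>R axis j 1)) differentiable (at 0)" for x
    using assms Cons.prems by (auto simp: C_b13_def)
  then have "partial j (\<lambda>y. - foldr partial js (\<psi> t) y) = (\<lambda>y. - partial j (foldr partial js (\<psi> t)) y)"
    unfolding partial_def
    by (intro ext DERIV_imp_deriv DERIV_minus) (simp add: DERIV_deriv_iff_real_differentiable)
  then show ?case using Cons by simp
qed simp

lemma
  assumes "\<psi> \<in> C_b13"
  shows C_b13_uminus: "(\<lambda>t y. - \<psi> t y) \<in> C_b13"
    and deriv_uminus_C_b13: "t > 0 \<Longrightarrow> deriv (\<lambda>s. - \<psi> s x) t = - deriv (\<lambda>s. \<psi> s x) t"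
    and hessian_uminus_C_b13: "t > 0 \<Longrightarrow> hessian (\<lambda>y. - \<psi> t y) x = - hessian (\<psi> t) x"
proof -
  show dt: "deriv (\<lambda>s. - \<psi> s x) t = - deriv (\<lambda>s. \<psi> s x) t" if "t > 0" for t x
    using assms that
    by (intro DERIV_imp_deriv DERIV_minus) (auto simp: DERIV_deriv_iff_real_differentiable C_b13_def)
  have f: "foldr partial js (\<lambda>y. - \<psi> t y) = (\<lambda>y. - foldr partial js (\<psi> t) y)" if "t > 0" "length js \<le> 3" for js t
    using foldr_partial_uminus[OF assms] that by blast
  show "hessian (\<lambda>y. - \<psi> t y) x = - hessian (\<psi> t) x" if "t > 0" for t x
    using f[OF that, of "[_, _]"] by (simp add: hessian_def vec_eq_iff)
  have "(\<lambda>h. foldr partial js (\<lambda>y. - \<psi> t y) (x + h *\<^sub>R axis i 1)) differentiable (at 0)"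
    if "length js < 3" "t > 0" for js i t x
    using assms that by (simp add: f C_b13_def)
  moreover have "continuous_on ({0<..} \<times> UNIV) (\<lambda>(t, x). foldr partial js (\<lambda>y. - \<psi> t y) x)" (is ?c)
    "bounded ((\<lambda>(t, x). foldr partial js (\<lambda>y. - \<psi> t y) x) ` ({0<..} \<times> UNIV))" (is ?b)
    if js: "length js \<le> 3" for js
  proof -
    have "continuous_on ({0<..} \<times> UNIV) (\<lambda>z. - (case z of (t, x) \<Rightarrow> foldr partial js (\<psi> t) x))"
      using assms js by (intro continuous_intros) (auto simp: C_b13_def)
    then show ?c by (rule continuous_on_eq) (auto simp: f js)
    have "bounded ((\<lambda>(t, x). foldr partial js (\<psi> t) x) ` ({0<..} \<times> UNIV))"
      using assms js by (auto simp: C_b13_def)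
    then show ?b by (auto simp: bounded_iff f js)
  qed
  moreover have "(\<lambda>s. - \<psi> s x) differentiable (at t)" if "t > 0" for t x
    using assms that by (auto simp: C_b13_def)
  moreover have "continuous_on ({0<..} \<times> UNIV) (\<lambda>(t, x). deriv (\<lambda>s. - \<psi> s x) t)"
  proof -
    have "continuous_on ({0<..} \<times> UNIV) (\<lambda>z. - (case z of (t, x) \<Rightarrow> deriv (\<lambda>s. \<psi> s x) t))"
      using assms by (intro continuous_intros) (auto simp: C_b13_def)
    then show ?thesis by (rule continuous_on_eq) (auto simp: dt)
  qed
  moreover have "bounded ((\<lambda>(t, x). deriv (\<lambda>s. - \<psi> s x) t) ` ({0<..} \<times> UNIV))"
  proof -
    have "bounded ((\<lambda>(t, x). deriv (\<lambda>s. \<psi> s x) t) ` ({0<..} \<times> UNIV))"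
      using assms by (auto simp: C_b13_def)
    then show ?thesis by (auto simp: bounded_iff dt)
  qed
  ultimately show "(\<lambda>t y. - \<psi> t y) \<in> C_b13" unfolding C_b13_def by blast
qed

text \<open>Negation exchanges local maxima and minima. This turns upper bounds on moments into
  lower ones and carries the equation from \<open>E\<close> to the lower expectation.\<close>

lemma viscosity_solution_uminus:
  assumes vs: "viscosity_solution F \<phi> u"
  shows "viscosity_solution (\<lambda>A. - F (- A)) (\<lambda>x. - \<phi> x) (\<lambda>t x. - u t x)"
proof -
  have "continuous_on ({0..} \<times> UNIV) (\<lambda>z. - (case z of (t, x) \<Rightarrow> u t x))"
    using vs by (intro continuous_intros) (simp add: viscosity_solution_def)
  then have "continuous_on ({0..} \<times> UNIV) (\<lambda>(t, x). - u t x)"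
    by (rule continuous_on_eq) auto
  moreover have "((\<forall>\<^sub>F (s, y) in nhds (t, x). - u s y - \<psi> s y \<le> - u t x - \<psi> t x) \<longrightarrow>
           deriv (\<lambda>s. \<psi> s x) t - - F (- hessian (\<psi> t) x) \<le> 0) \<and>
        ((\<forall>\<^sub>F (s, y) in nhds (t, x). - u s y - \<psi> s y \<ge> - u t x - \<psi> t x) \<longrightarrow>
           deriv (\<lambda>s. \<psi> s x) t - - F (- hessian (\<psi> t) x) \<ge> 0)"
    if \<psi>: "\<psi> \<in> C_b13" and t: "t > 0" for \<psi> t x
  proof -
    let ?\<psi> = "\<lambda>t y. - \<psi> t y"
    have *: "((\<forall>\<^sub>F (s, y) in nhds (t, x). u s y - ?\<psi> s y \<le> u t x - ?\<psi> t x) \<longrightarrow>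
           deriv (\<lambda>s. ?\<psi> s x) t - F (hessian (?\<psi> t) x) \<le> 0) \<and>
        ((\<forall>\<^sub>F (s, y) in nhds (t, x). u s y - ?\<psi> s y \<ge> u t x - ?\<psi> t x) \<longrightarrow>
           deriv (\<lambda>s. ?\<psi> s x) t - F (hessian (?\<psi> t) x) \<ge> 0)"
      by (rule viscosity_solutionD[OF vs C_b13_uminus[OF \<psi>] t])
    have "(\<lambda>(s, y). - u s y - \<psi> s y \<le> - u t x - \<psi> t x) = (\<lambda>(s, y). u s y - ?\<psi> s y \<ge> u t x - ?\<psi> t x)"
      "(\<lambda>(s, y). - u s y - \<psi> s y \<ge> - u t x - \<psi> t x) = (\<lambda>(s, y). u s y - ?\<psi> s y \<le> u t x - ?\<psi> t x)"
      by (auto simp: fun_eq_iff)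
    then show ?thesis
      using * unfolding deriv_uminus_C_b13[OF \<psi> t] hessian_uminus_C_b13[OF \<psi> t] by argo
  qed
  moreover have "\<forall>x. - u 0 x = - \<phi> x" using vs by (simp add: viscosity_solution_def)
  ultimately show ?thesis unfolding viscosity_solution_def by blast
qed

section \<open>Sublinear expectations and the \<open>G\<close>-expectation\<close>

locale sublinear_space =
  fixes L :: "('w \<Rightarrow> real) set" and E :: "('w \<Rightarrow> real) \<Rightarrow> real"
  assumes sublinear: "sublinear_expectation L E"
begin

lemma
  shows L_const: "(\<lambda>_. c) \<in> L"
    and L_add: "X \<in> L \<Longrightarrow> Y \<in> L \<Longrightarrow> (\<lambda>\<omega>. X \<omega> + Y \<omega>) \<in> L"
    and L_cmult: "X \<in> L \<Longrightarrow> (\<lambda>\<omega>. c * X \<omega>) \<in> L"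
    and L_abs: "X \<in> L \<Longrightarrow> (\<lambda>\<omega>. \<bar>X \<omega>\<bar>) \<in> L"
    and E_const: "E (\<lambda>_. c) = c"
    and E_mono: "X \<in> L \<Longrightarrow> Y \<in> L \<Longrightarrow> (\<And>\<omega>. X \<omega> \<le> Y \<omega>) \<Longrightarrow> E X \<le> E Y"
    and E_subadd: "X \<in> L \<Longrightarrow> Y \<in> L \<Longrightarrow> E (\<lambda>\<omega>. X \<omega> + Y \<omega>) \<le> E X + E Y"
    and E_cmult: "X \<in> L \<Longrightarrow> c \<ge> 0 \<Longrightarrow> E (\<lambda>\<omega>. c * X \<omega>) = c * E X"
  using sublinear unfolding sublinear_expectation_def by blast+

lemma L_uminus: "X \<in> L \<Longrightarrow> (\<lambda>\<omega>. - X \<omega>) \<in> L"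
  using L_cmult[of X "-1"] by simp

lemma L_diff: "X \<in> L \<Longrightarrow> Y \<in> L \<Longrightarrow> (\<lambda>\<omega>. X \<omega> - Y \<omega>) \<in> L"
  using L_add[OF _ L_uminus, of X Y] by simp

lemma E_add_uminus_nonneg: "X \<in> L \<Longrightarrow> 0 \<le> E X + E (\<lambda>\<omega>. - X \<omega>)"
  using E_subadd[OF _ L_uminus, of X X] by (simp add: E_const)

text \<open>A variable whose upper and lower means agree adds linearly, whatever its dependence on
  \<open>X\<close>. Linear functions of \<open>B t\<close> turn out to be of this kind.\<close>

lemma E_add_certain:
  assumes X: "X \<in> L" and Y: "Y \<in> L" and m: "E Y = m" "E (\<lambda>\<omega>. - Y \<omega>) = - m"
  shows "E (\<lambda>\<omega>. X \<omega> + Y \<omega>) = E X + m"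
proof (rule antisym)
  show "E (\<lambda>\<omega>. X \<omega> + Y \<omega>) \<le> E X + m" using E_subadd[OF X Y] m by simp
  have "E (\<lambda>\<omega>. (X \<omega> + Y \<omega>) + - Y \<omega>) \<le> E (\<lambda>\<omega>. X \<omega> + Y \<omega>) + E (\<lambda>\<omega>. - Y \<omega>)"
    by (intro E_subadd L_add L_uminus X Y)
  then show "E X + m \<le> E (\<lambda>\<omega>. X \<omega> + Y \<omega>)" using m by simp
qed

lemma E_add_const: "X \<in> L \<Longrightarrow> E (\<lambda>\<omega>. X \<omega> + c) = E X + c"
  by (intro E_add_certain L_const E_const)

text \<open>The supremum of \<open>c * m\<close> over all \<open>m\<close> between the lower and the
  upper mean of \<open>X\<close>, split into an even and an odd part in \<open>c\<close>. When
  \<open>c\<close> is later replaced by a centred variable, only the even part survives.\<close>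

lemma E_cmult_max:
  assumes "X \<in> L"
  shows "E (\<lambda>\<omega>. c * X \<omega>) = (E X + E (\<lambda>\<omega>. - X \<omega>)) / 2 * \<bar>c\<bar> + (E X - E (\<lambda>\<omega>. - X \<omega>)) / 2 * c"
proof (cases "c \<ge> 0")
  case True
  then show ?thesis using E_cmult[OF assms True] by (simp add: field_simps)
next
  case False
  then show ?thesis using E_cmult[OF L_uminus[OF assms], of "- c"] by (simp add: field_simps)
qed

lemma E_diff_le_abs:
  assumes X: "X \<in> L" and Y: "Y \<in> L"
  shows "\<bar>E X - E Y\<bar> \<le> E (\<lambda>\<omega>. \<bar>X \<omega> - Y \<omega>\<bar>)"
proof -
  have *: "E X \<le> E Y + E (\<lambda>\<omega>. \<bar>X \<omega> - Y \<omega>\<bar>)" if "X \<in> L" "Y \<in> L" for X Y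
    using E_mono[OF that(1), of "\<lambda>\<omega>. Y \<omega> + \<bar>X \<omega> - Y \<omega>\<bar>"]
      E_subadd[OF that(2), of "\<lambda>\<omega>. \<bar>X \<omega> - Y \<omega>\<bar>"] that
    by (force intro: L_add L_abs L_diff)
  show ?thesis using *[OF X Y] *[OF Y X] by (simp add: abs_minus_commute abs_le_iff)
qed

text \<open>Truncation at level \<open>K\<close>: below it, x^2 is at most K|x|, which has mean
  zero; above it, x^2 is at most x^4/K^2, and the fourth moment has a finite value.\<close>

lemma E_square_zero_if_E_abs_zero:
  assumes L: "W \<in> L" "(\<lambda>\<omega>. (W \<omega>)\<^sup>2) \<in> L" "(\<lambda>\<omega>. W \<omega> ^ 4) \<in> L" and 0: "E (\<lambda>\<omega>. \<bar>W \<omega>\<bar>) = 0"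
  shows "E (\<lambda>\<omega>. (W \<omega>)\<^sup>2) \<le> 0"
proof (rule ccontr)
  assume "\<not> ?thesis"
  then have pos: "E (\<lambda>\<omega>. (W \<omega>)\<^sup>2) > 0" by simp
  define m where "m = E (\<lambda>\<omega>. W \<omega> ^ 4)"
  \<comment> \<open>Chosen so that the fourth-moment term is at most half of the second moment; the
    summand 1 avoids a zero denominator.\<close>
  define \<delta> where "\<delta> = E (\<lambda>\<omega>. (W \<omega>)\<^sup>2) / (2 * (\<bar>m\<bar> + 1))"
  have \<delta>: "\<delta> > 0" using pos by (simp add: \<delta>_def)
  define K where "K = 1 / sqrt \<delta>"
  have K: "K > 0" "K\<^sup>2 * \<delta> = 1" using \<delta> by (auto simp: K_def power_divide)
  have le: "x\<^sup>2 \<le> K * \<bar>x\<bar> + \<delta> * x ^ 4" for x :: real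
  proof (cases "\<bar>x\<bar> \<le> K")
    case True
    then have "x\<^sup>2 \<le> K * \<bar>x\<bar>"
      using mult_right_mono[of "\<bar>x\<bar>" K "\<bar>x\<bar>"] by (simp add: power2_eq_square abs_mult_self_eq)
    then show ?thesis using \<delta> by (simp add: add_increasing2)
  next
    case False
    then have "K\<^sup>2 \<le> x\<^sup>2" using K(1) by (simp add: abs_le_square_iff[symmetric])
    then have "K\<^sup>2 * (\<delta> * x\<^sup>2) \<le> x\<^sup>2 * (\<delta> * x\<^sup>2)" using \<delta> by (intro mult_right_mono) auto
    moreover have "K\<^sup>2 * (\<delta> * x\<^sup>2) = x\<^sup>2" using K(2) by (simp flip: mult.assoc)
    moreover have "x\<^sup>2 * (\<delta> * x\<^sup>2) = \<delta> * x ^ 4" by (simp add: power2_eq_square power4_eq_xxxx)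
    moreover have "0 \<le> K * \<bar>x\<bar>" using K by simp
    ultimately show ?thesis by linarith
  qed
  have "E (\<lambda>\<omega>. (W \<omega>)\<^sup>2) \<le> E (\<lambda>\<omega>. K * \<bar>W \<omega>\<bar> + \<delta> * W \<omega> ^ 4)"
    by (intro E_mono L L_add L_cmult L_abs le)
  also have "\<dots> \<le> E (\<lambda>\<omega>. K * \<bar>W \<omega>\<bar>) + E (\<lambda>\<omega>. \<delta> * W \<omega> ^ 4)"
    by (intro E_subadd L L_cmult L_abs)
  also have "\<dots> = \<delta> * m"
    using E_cmult[OF L_abs[OF L(1)], of K] E_cmult[OF L(3), of \<delta>] K \<delta> 0 by (simp add: m_def)
  also have "\<dots> \<le> \<delta> * (\<bar>m\<bar> + 1)" using \<delta> by (intro mult_left_mono) auto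
  also have "\<dots> = E (\<lambda>\<omega>. (W \<omega>)\<^sup>2) / 2"
  proof -
    have *: "x / (2 * a) * a = x / 2" if "a > 0" for x a :: real using that by simp
    show ?thesis unfolding \<delta>_def by (rule *) simp
  qed
  finally show False using pos by simp
qed

end

section \<open>Independence and cylinder random variables\<close>

lemma indep_vectorD:
  assumes "indep_vector E n Y m X" and "\<phi> \<in> C_lLip (pair_norm m n)"
  shows "E (\<lambda>\<omega>. \<phi> (\<lambda>k. X k \<omega>, \<lambda>k. Y k \<omega>)) =
    E (\<lambda>\<omega>. E (\<lambda>\<omega>'. \<phi> (\<lambda>k. X k \<omega>, \<lambda>k. Y k \<omega>')))"
  using assms unfolding indep_vector_def by blast

lemma B_0 [simp]: "B 0 \<omega> = 0"
  using Rep_cpath[of \<omega>] by (simp add: B_def)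

text \<open>The cylinder random variables depending on the times \<open>t 0, \<dots>, t (n - 1)\<close> only.\<close>
definition rv :: "nat \<Rightarrow> (nat \<Rightarrow> real) \<Rightarrow> ('d::finite cpath \<Rightarrow> real) set" where
  "rv n t = {\<lambda>\<omega>. \<phi> (\<lambda>k. B (t k) \<omega>) |\<phi>. \<phi> \<in> C_lLip (vec_norm n)}"

lemma rv_const: "(\<lambda>_. c) \<in> rv n t"
  unfolding rv_def using C_lLip_const[of "vec_norm n" c, OF vec_norm_nonneg] by (auto intro!: exI[of _ "\<lambda>_. c"])

lemma rv_add: "X \<in> rv n t \<Longrightarrow> Y \<in> rv n t \<Longrightarrow> (\<lambda>\<omega>. X \<omega> + Y \<omega>) \<in> rv n t"
  unfolding rv_def using C_lLip_add[OF vec_norm_nonneg] by fast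

lemma rv_mult: "X \<in> rv n t \<Longrightarrow> Y \<in> rv n t \<Longrightarrow> (\<lambda>\<omega>. X \<omega> * Y \<omega>) \<in> rv n t"
  unfolding rv_def using C_lLip_mult[OF lip_gauge_vec_norm] by fast

lemma rv_nth: "k < n \<Longrightarrow> (\<lambda>\<omega>. B (t k) \<omega> $ i) \<in> rv n t"
  unfolding rv_def using C_lLip_vec_coord[OF _ abs_nth_diff_le_norm, of k n i] by fast

lemma rv_uminus: "X \<in> rv n t \<Longrightarrow> (\<lambda>\<omega>. - X \<omega>) \<in> rv n t"
  using rv_mult[OF rv_const[of "-1"]] by fastforce

lemma rv_diff: "X \<in> rv n t \<Longrightarrow> Y \<in> rv n t \<Longrightarrow> (\<lambda>\<omega>. X \<omega> - Y \<omega>) \<in> rv n t"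
  using rv_add[OF _ rv_uminus, of X n t Y] by simp

lemma rv_power: "X \<in> rv n t \<Longrightarrow> (\<lambda>\<omega>. X \<omega> ^ m) \<in> rv n t"
  by (induction m) (auto intro: rv_const rv_mult)

lemma rv_sum: "(\<And>a. a \<in> A \<Longrightarrow> f a \<in> rv n t) \<Longrightarrow> (\<lambda>\<omega>. \<Sum>a\<in>A. f a \<omega>) \<in> rv n t"
  by (induction A rule: infinite_finite_induct) (auto intro: rv_const rv_add)

lemma rv_inner: "k < n \<Longrightarrow> (\<lambda>\<omega>. q \<bullet> B (t k) \<omega>) \<in> rv n t"
  unfolding inner_vec_def by (intro rv_sum) (auto intro: rv_mult rv_const rv_nth)

lemmas rv_intros = rv_const rv_add rv_mult rv_nth rv_uminus rv_diff rv_power rv_sum rv_inner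

lemma C_lLip_inner: "(\<lambda>x. q \<bullet> x) \<in> C_lLip (norm :: real^'d::finite \<Rightarrow> real)"
  unfolding inner_vec_def
  by (intro C_lLip_sum) (auto intro!: C_lLip_mult C_lLip_const C_lLip_nth lip_gauge_norm)

lemma compact_covariance_image:
  fixes \<Gamma> :: "(real^'d^'d::finite) set"
  assumes "bounded \<Gamma>" "closed \<Gamma>"
  shows "compact ((\<lambda>\<gamma>. \<gamma> ** transpose \<gamma>) ` \<Gamma>)"
proof (rule compact_continuous_image)
  show "compact \<Gamma>" using assms by (simp add: compact_eq_bounded_closed)
  show "continuous_on \<Gamma> (\<lambda>\<gamma>. \<gamma> ** transpose \<gamma>)"
    unfolding matrix_matrix_mult_def transpose_def
    by (intro continuous_on_vec_lambda continuous_intros)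
qed

lemma trace_mult_eq_sum: "trace (C ** A) = (\<Sum>i\<in>UNIV. \<Sum>k\<in>UNIV. C $ i $ k * A $ k $ i)"
  by (simp add: trace_def matrix_matrix_mult_def)

lemma continuous_on_trace_mult: "continuous_on S (\<lambda>C. trace (C ** A))"
  for A :: "real^'d^'d::finite"
  unfolding trace_mult_eq_sum by (intro continuous_intros)

lemma bdd_above_continuous_image:
  fixes f :: "'a::topological_space \<Rightarrow> real"
  assumes "compact S" "continuous_on S f"
  shows "bdd_above (f ` S)"
  using compact_imp_bounded[OF compact_continuous_image[OF assms(2,1)]] by (rule bounded_imp_bdd_above)

lemma SUP_cmult_pos:
  fixes f :: "'a \<Rightarrow> real"
  assumes "S \<noteq> {}" "bdd_above (f ` S)" "c > 0"
  shows "(SUP x\<in>S. c * f x) = c * (SUP x\<in>S. f x)"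
proof (rule antisym)
  show "(SUP x\<in>S. c * f x) \<le> c * (SUP x\<in>S. f x)"
    using assms by (intro cSUP_least mult_left_mono cSUP_upper) auto
  have bdd: "bdd_above ((\<lambda>x. c * f x) ` S)"
  proof -
    obtain M where "\<And>x. x \<in> S \<Longrightarrow> f x \<le> M" using assms(2) by (auto simp: bdd_above_def)
    then show ?thesis using assms(3) by (intro bdd_aboveI[of _ "c * M"]) auto
  qed
  have "(SUP x\<in>S. f x) \<le> (SUP x\<in>S. c * f x) / c"
    using assms(1,3) cSUP_upper[OF _ bdd] by (intro cSUP_least) (auto simp: pos_le_divide_eq mult.commute)
  then show "c * (SUP x\<in>S. f x) \<le> (SUP x\<in>S. c * f x)"
    using assms(3) by (simp add: pos_le_divide_eq mult.commute)
qed

locale G_expectation_space =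
  fixes \<Gamma> :: "(real^'d^'d::finite) set" and L :: "('d cpath \<Rightarrow> real) set" and E
  assumes \<Gamma>: "\<Gamma> \<noteq> {}" "bounded \<Gamma>" "closed \<Gamma>" and G: "G_expectation \<Gamma> L E"
begin

sublocale sublinear_space L E
  using G by unfold_locales (simp add: G_expectation_def)

text \<open>The space \<open>L\<close> is a vector lattice with no product, so products and powers
  of coordinates are shown to lie in \<open>L\<close> as cylinder variables.\<close>

lemma L_rv:
  assumes "X \<in> rv n t" "\<And>k. 0 \<le> t k"
  shows "X \<in> L"
proof -
  have "X \<in> L_ip" using assms unfolding rv_def L_ip_def by blast
  then show ?thesis using G by (auto simp: G_expectation_def)
qed

lemma viscosity_E:
  "\<phi> \<in> C_lLip norm \<Longrightarrow> viscosity_solution (G_upper \<Gamma>) \<phi> (\<lambda>t x. E (\<lambda>\<omega>. \<phi> (x + B t \<omega>)))"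
  using G by (simp add: G_expectation_def)

lemma stationary:
  "\<phi> \<in> C_lLip norm \<Longrightarrow> 0 \<le> s \<Longrightarrow> 0 \<le> t \<Longrightarrow> E (\<lambda>\<omega>. \<phi> (B (s + t) \<omega> - B s \<omega>)) = E (\<lambda>\<omega>. \<phi> (B t \<omega>))"
  using G by (simp add: G_expectation_def)

lemma indep_increment:
  "0 \<le> s \<Longrightarrow> 0 \<le> t \<Longrightarrow> (\<And>k. 0 \<le> r k \<and> r k \<le> s) \<Longrightarrow>
     indep_vector E 1 (\<lambda>_ \<omega>. B (s + t) \<omega> - B s \<omega>) m (\<lambda>k. B (r k))"
  using G unfolding G_expectation_def by blast

section \<open>Covariance matrices and the moments they determine\<close>

abbreviation "cov \<equiv> (\<lambda>\<gamma>. \<gamma> ** transpose \<gamma>) ` \<Gamma>"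

lemma cov_nonempty_compact: "cov \<noteq> {}" "compact cov"
  using \<Gamma> compact_covariance_image by auto

lemma cov_symmetric: "C \<in> cov \<Longrightarrow> C $ i $ j = C $ j $ i"
  by (auto simp: matrix_matrix_mult_def transpose_def mult.commute)

lemma cov_diag_nonneg: "C \<in> cov \<Longrightarrow> 0 \<le> C $ i $ i"
  by (auto simp: matrix_matrix_mult_def transpose_def intro!: sum_nonneg)

lemma bdd_above_cov: "continuous_on cov f \<Longrightarrow> bdd_above (f ` cov)" for f :: "_ \<Rightarrow> real"
  by (rule bdd_above_continuous_image[OF cov_nonempty_compact(2)])

lemma G_upper_eq: "G_upper \<Gamma> A = (SUP C\<in>cov. trace (C ** A)) / 2"
  by (simp add: G_upper_def image_image)

text \<open>The bounded majorant of a linear datum has Hessian of order \<open>\<epsilon>\<close>.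
  Since \<open>G_upper\<close> is positively homogeneous, the resulting bound is linear in
  \<open>\<epsilon>\<close> and tends to 0.\<close>

lemma E_inner_nonpos:
  assumes "t \<ge> 0"
  shows "E (\<lambda>\<omega>. q \<bullet> B t \<omega>) \<le> 0"
proof -
  let ?g = "G_upper \<Gamma> (quad_hess 0 0 0 0 1 q)"
  have le: "E (\<lambda>\<omega>. q \<bullet> B t \<omega>) \<le> \<epsilon> * (t * ?g)" if \<epsilon>: "\<epsilon> > 0" for \<epsilon>
  proof -
    have "E (\<lambda>\<omega>. q \<bullet> (y + B s \<omega>)) = 0 * (0 \<bullet> y)\<^sup>2 + 0 * (0 \<bullet> y)\<^sup>2 + 1 * (q \<bullet> y) + E (\<lambda>\<omega>. q \<bullet> B s \<omega>)"
      if "s \<ge> 0" for s y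
      using E_add_const[OF L_rv[OF rv_inner[of 0 1 q "\<lambda>_. s"]], of "q \<bullet> y"] that
      by (simp add: inner_add_right add.commute)
    then have "E (\<lambda>\<omega>. q \<bullet> B t \<omega>) \<le> t * G_upper \<Gamma> (quad_hess 0 0 0 0 \<epsilon> q)"
      by (rule viscosity_quadratic_le[OF viscosity_E[OF C_lLip_inner] \<epsilon>, where f = "\<lambda>s. E (\<lambda>\<omega>. q \<bullet> B s \<omega>)"])
        (simp_all add: E_const assms)
    also have "trace (C ** quad_hess 0 0 0 0 \<epsilon> q) = \<epsilon> * trace (C ** quad_hess 0 0 0 0 1 q)" for C
      by (simp add: trace_mult_eq_sum quad_hess_def sum_distrib_left mult_ac)
    then have "G_upper \<Gamma> (quad_hess 0 0 0 0 \<epsilon> q) = \<epsilon> * ?g"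
      unfolding G_upper_eq
      using SUP_cmult_pos[OF cov_nonempty_compact(1) bdd_above_cov[OF continuous_on_trace_mult] \<epsilon>] by simp
    finally show ?thesis by (simp add: mult_ac)
  qed
  have "((\<lambda>\<epsilon>. \<epsilon> * (t * ?g)) \<longlongrightarrow> 0 * (t * ?g)) (at_right 0)" by (intro tendsto_intros)
  moreover have "\<forall>\<^sub>F \<epsilon> in at_right 0. E (\<lambda>\<omega>. q \<bullet> B t \<omega>) \<le> \<epsilon> * (t * ?g)"
    using eventually_at_right_less[of "0 :: real"] by eventually_elim (rule le)
  ultimately show ?thesis
    using tendsto_lowerbound[of _ "0 * (t * ?g)" "at_right 0"] by fastforce
qed

lemma E_inner:
  assumes "t \<ge> 0"
  shows "E (\<lambda>\<omega>. q \<bullet> B t \<omega>) = 0"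
  using E_inner_nonpos[OF assms, of q] E_inner_nonpos[OF assms, of "- q"]
    E_add_uminus_nonneg[OF L_rv[OF rv_inner[of 0 1 q "\<lambda>_. t"]]] assms
  by simp

lemma E_add_inner:
  assumes "X \<in> L" "t \<ge> 0"
  shows "E (\<lambda>\<omega>. X \<omega> + q \<bullet> B t \<omega>) = E X"
  using E_add_certain[OF assms(1) L_rv[OF rv_inner[of 0 1 q "\<lambda>_. t"]], of 0]
    E_inner[OF assms(2), of q] E_inner[OF assms(2), of "- q"] assms(2) by simp

lemma E_cmult_B: "t \<ge> 0 \<Longrightarrow> E (\<lambda>\<omega>. c * B t \<omega> $ i) = 0"
  using E_inner[of t "c *\<^sub>R axis i 1"] by (simp add: inner_axis' )

text \<open>Expanding the product at \<open>y + B s\<close>, the cross terms are linear in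
  \<open>B s\<close> and drop out, so the value function is the datum plus \<open>f s\<close>. The
  comparison in time, applied to it and to its negative, determines \<open>f\<close>.\<close>

lemma E_B_product:
  assumes t: "t \<ge> 0"
  shows "E (\<lambda>\<omega>. c * (B t \<omega> $ i * B t \<omega> $ j)) = t * (SUP C\<in>cov. c * C $ i $ j)"
proof -
  \<comment> \<open>Polarisation: a quarter of the difference of the squares of
    \<open>v \<bullet> y\<close> and \<open>w \<bullet> y\<close> is \<open>y $ i * y $ j\<close>.
    The case \<open>i = j\<close> is included, with \<open>w = 0\<close>.\<close>
  define v where "v = axis i (1::real) + axis j 1"
  define w where "w = axis i (1::real) - axis j 1"
  define f where "f s = E (\<lambda>\<omega>. c * (B s \<omega> $ i * B s \<omega> $ j))" for s
  define u where "u s y = E (\<lambda>\<omega>. c * ((y + B s \<omega>) $ i * (y + B s \<omega>) $ j))" for s y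
  define A where "A = quad_hess (c / 4) v (- c / 4) w 1 0"
  have "(\<lambda>x. c * (x $ i * x $ j)) \<in> C_lLip (norm :: real^'d \<Rightarrow> real)"
    by (intro C_lLip_cmult C_lLip_mult C_lLip_nth lip_gauge_norm)
  from viscosity_E[OF this]
  have vs: "viscosity_solution (G_upper \<Gamma>) (\<lambda>x. c * (x $ i * x $ j)) u"
    by (simp add: u_def[abs_def])
  have poly: "c / 4 * (v \<bullet> y)\<^sup>2 + (- c / 4) * (w \<bullet> y)\<^sup>2 = c * (y $ i * y $ j)" for y
    by (simp add: v_def w_def inner_add_left inner_diff_left inner_axis' power2_eq_square field_simps)
  have u: "u s y = c * (y $ i * y $ j) + f s" if "s \<ge> 0" for s y
  proof -
    have "u s y = E (\<lambda>\<omega>. (c * (B s \<omega> $ i * B s \<omega> $ j) + c * (y $ i * y $ j)) +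
        (\<lambda>\<omega>. (c * y $ i) *\<^sub>R axis j 1 + (c * y $ j) *\<^sub>R axis i 1) \<omega> \<bullet> B s \<omega>)"
      unfolding u_def by (intro arg_cong[of _ _ E] ext)
        (simp add: inner_add_left inner_axis' algebra_simps)
    also have "\<dots> = E (\<lambda>\<omega>. c * (B s \<omega> $ i * B s \<omega> $ j) + c * (y $ i * y $ j))"
      using that by (intro E_add_inner L_rv[of _ 1 "\<lambda>_. s"] rv_intros) auto
    also have "\<dots> = f s + c * (y $ i * y $ j)"
      unfolding f_def using that by (intro E_add_const L_rv[of _ 1 "\<lambda>_. s"] rv_intros) auto
    finally show ?thesis by simp
  qed
  have f0: "f 0 = 0" by (simp add: f_def E_const)
  have "f t \<le> t * G_upper \<Gamma> A" unfolding A_def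
  proof (rule viscosity_quadratic_le[where f = f and e = 0 and q = 0, OF vs zero_less_one _ f0 t])
    show "u s y = c / 4 * (v \<bullet> y)\<^sup>2 + - c / 4 * (w \<bullet> y)\<^sup>2 + 0 * (0 \<bullet> y) + f s" if "s \<ge> 0" for s y
      using poly[of y] u[OF that, of y] by (simp add: algebra_simps)
  qed
  \<comment> \<open>The datum and its Hessian change sign, and the operator for \<open>- u\<close>
    changes it back, so the same value of \<open>G_upper\<close> bounds \<open>f\<close> from
    below.\<close>
  moreover have "- f t \<le> t * (- G_upper \<Gamma> (- quad_hess (- c / 4) v (c / 4) w 1 0))"
  proof (rule viscosity_quadratic_le[where f = "\<lambda>s. - f s" and e = 0 and q = 0,
        OF viscosity_solution_uminus[OF vs] zero_less_one _ _ t])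
    show "- u s y = - c / 4 * (v \<bullet> y)\<^sup>2 + c / 4 * (w \<bullet> y)\<^sup>2 + 0 * (0 \<bullet> y) + - f s" if "s \<ge> 0" for s y
      using poly[of y] u[OF that, of y] by (simp add: algebra_simps)
  qed (simp add: f0)
  moreover have "- quad_hess (- c / 4) v (c / 4) w 1 0 = A"
    by (simp add: A_def quad_hess_def vec_eq_iff)
  ultimately have "f t = t * G_upper \<Gamma> A" by simp
  moreover have "G_upper \<Gamma> A = (SUP C\<in>cov. c * C $ i $ j)"
  proof -
    have A: "A $ k $ l = c * (axis i 1 $ k * axis j 1 $ l + axis j 1 $ k * axis i 1 $ l)" for k l
      by (simp add: A_def quad_hess_def v_def w_def field_simps)
    have "trace (C ** A) = c * (C $ i $ j + C $ j $ i)" for C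
    proof -
      have "trace (C ** A) = (\<Sum>l\<in>UNIV. \<Sum>k\<in>UNIV. (if k = i then if l = j then c * C $ l $ k else 0 else 0) +
          (if k = j then if l = i then c * C $ l $ k else 0 else 0))"
        unfolding trace_mult_eq_sum A by (intro sum.cong refl) (simp add: axis_def distrib_left)
      also have "\<dots> = c * (C $ i $ j + C $ j $ i)"
        by (simp add: sum.distrib algebra_simps)
      finally show ?thesis .
    qed
    then have "(SUP C\<in>cov. trace (C ** A)) = (SUP C\<in>cov. 2 * (c * C $ i $ j))"
      using cov_symmetric[of _ i j] by (intro SUP_cong refl) simp
    also have "\<dots> = 2 * (SUP C\<in>cov. c * C $ i $ j)"
      by (intro SUP_cmult_pos cov_nonempty_compact bdd_above_cov continuous_intros) simp
    finally show ?thesis by (simp add: G_upper_eq)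
  qed
  ultimately show ?thesis by (simp add: f_def)
qed

section \<open>Quadratic variation through independent increments\<close>

lemma E_B_square: "t \<ge> 0 \<Longrightarrow> E (\<lambda>\<omega>. c * (B t \<omega> $ i)\<^sup>2) = t * E (\<lambda>\<omega>. c * (B 1 \<omega> $ i)\<^sup>2)"
  using E_B_product[of t c i i] E_B_product[of 1 c i i] by (simp add: power2_eq_square)

lemma E_increment_square:
  assumes "s \<ge> 0" "t \<ge> 0"
  shows "E (\<lambda>\<omega>. c * (B (s + t) \<omega> $ i - B s \<omega> $ i)\<^sup>2) = E (\<lambda>\<omega>. c * (B t \<omega> $ i)\<^sup>2)"
  using stationary[OF C_lLip_cmult[OF lip_gauge_norm C_lLip_power[OF lip_gauge_norm C_lLip_nth]] assms, of c i 2]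
  by simp

lemma L_sum_increment_squares:
  fixes d :: real
  assumes "d \<ge> 0"
  shows "(\<lambda>\<omega>. \<Sum>k<m. (B (Suc k * d) \<omega> $ i - B (k * d) \<omega> $ i)\<^sup>2) \<in> L"
proof (rule L_rv)
  have "(\<lambda>\<omega>. (B (Suc k * d) \<omega> $ i - B (k * d) \<omega> $ i)\<^sup>2) \<in> rv (Suc m) (\<lambda>k. k * d)" if "k < m" for k
    using rv_nth[of k "Suc m" "\<lambda>k. k * d" i] rv_nth[of "Suc k" "Suc m" "\<lambda>k. k * d" i] that
    by (intro rv_power rv_diff) auto
  then show "(\<lambda>\<omega>. \<Sum>k<m. (B (Suc k * d) \<omega> $ i - B (k * d) \<omega> $ i)\<^sup>2) \<in> rv (Suc m) (\<lambda>k. k * d)"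
    by (intro rv_sum) auto
qed (use assms in auto)

text \<open>With the past frozen, the last squared increment contributes a constant, so here
  \<open>E\<close> is additive and not merely subadditive. Both signs of \<open>c\<close> are
  allowed in order to reach the lower expectation too.\<close>

lemma E_sum_increment_squares:
  fixes d :: real
  assumes d: "d \<ge> 0"
  shows "E (\<lambda>\<omega>. c * (\<Sum>k<m. (B (Suc k * d) \<omega> $ i - B (k * d) \<omega> $ i)\<^sup>2))
     = m * d * E (\<lambda>\<omega>. c * (B 1 \<omega> $ i)\<^sup>2)"
proof (induction m)
  case 0
  show ?case by (simp add: E_const)
next
  case (Suc m)
  \<comment> \<open>Independence from the past asks that all times \<open>r k\<close> be at most
    \<open>m * d\<close>, including those beyond the first \<open>Suc m\<close>; hence the
    truncation.\<close>
  define r where "r k = min k m * d" for k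
  define X where "X \<omega> = c * (\<Sum>k<m. (B (Suc k * d) \<omega> $ i - B (k * d) \<omega> $ i)\<^sup>2)" for \<omega>
  define \<phi> where "\<phi> = (\<lambda>p :: (nat \<Rightarrow> real^'d) \<times> (nat \<Rightarrow> real^'d).
    c * (\<Sum>k<m. (fst p (Suc k) $ i - fst p k $ i)\<^sup>2) + c * (snd p 0 $ i)\<^sup>2)"
  have \<phi>: "\<phi> \<in> C_lLip (pair_norm (Suc m) 1)" unfolding \<phi>_def
    by (intro C_lLip_add C_lLip_cmult C_lLip_sum C_lLip_power C_lLip_diff lip_gauge_pair_norm
        lip_gauge_nonneg[OF lip_gauge_pair_norm] C_lLip_pair_fst C_lLip_pair_snd abs_nth_diff_le_norm) auto
  have r: "0 \<le> r k \<and> r k \<le> m * d" for k using d by (auto simp: r_def intro!: mult_right_mono)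
  have XL: "X \<in> L" unfolding X_def by (intro L_cmult L_sum_increment_squares d)
  have "E (\<lambda>\<omega>. c * (\<Sum>k<Suc m. (B (Suc k * d) \<omega> $ i - B (k * d) \<omega> $ i)\<^sup>2)) =
      E (\<lambda>\<omega>. \<phi> (\<lambda>k. B (r k) \<omega>, \<lambda>k. B (m * d + d) \<omega> - B (m * d) \<omega>))"
    by (intro arg_cong[of _ _ E] ext) (simp add: \<phi>_def r_def min_def algebra_simps)
  also have "\<dots> = E (\<lambda>\<omega>. E (\<lambda>\<omega>'. \<phi> (\<lambda>k. B (r k) \<omega>, \<lambda>k. B (m * d + d) \<omega>' - B (m * d) \<omega>')))"
    using d by (intro indep_vectorD[OF indep_increment \<phi>] r) auto
  also have "(\<lambda>\<omega>. E (\<lambda>\<omega>'. \<phi> (\<lambda>k. B (r k) \<omega>, \<lambda>k. B (m * d + d) \<omega>' - B (m * d) \<omega>'))) =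
      (\<lambda>\<omega>. X \<omega> + d * E (\<lambda>\<omega>. c * (B 1 \<omega> $ i)\<^sup>2))"
  proof
    fix \<omega>
    have "E (\<lambda>\<omega>'. \<phi> (\<lambda>k. B (r k) \<omega>, \<lambda>k. B (m * d + d) \<omega>' - B (m * d) \<omega>')) =
        E (\<lambda>\<omega>'. c * (B (m * d + d) \<omega>' $ i - B (m * d) \<omega>' $ i)\<^sup>2 + X \<omega>)"
      by (simp add: \<phi>_def X_def r_def min_def add.commute)
    also have "\<dots> = E (\<lambda>\<omega>'. c * (B (m * d + d) \<omega>' $ i - B (m * d) \<omega>' $ i)\<^sup>2) + X \<omega>"
      using d by (intro E_add_const L_rv[of _ 2 "\<lambda>k. if k = 0 then m * d else m * d + d"] rv_intros)
        (auto intro: rv_nth[of 0 2 "\<lambda>k. if k = 0 then m * d else m * d + d", simplified]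
          rv_nth[of 1 2 "\<lambda>k. if k = 0 then m * d else m * d + d", simplified])
    finally show "E (\<lambda>\<omega>'. \<phi> (\<lambda>k. B (r k) \<omega>, \<lambda>k. B (m * d + d) \<omega>' - B (m * d) \<omega>')) =
        X \<omega> + d * E (\<lambda>\<omega>. c * (B 1 \<omega> $ i)\<^sup>2)"
      using E_increment_square[of "m * d" d c i] E_B_square[of d c i] d by simp
  qed
  also have "E \<dots> = E X + d * E (\<lambda>\<omega>. c * (B 1 \<omega> $ i)\<^sup>2)" by (rule E_add_const[OF XL])
  finally show ?case using Suc.IH by (simp add: X_def[abs_def] algebra_simps)
qed

text \<open>Along every equidistant partition of [0,1] the sum of squares already has the
  expectation of the squared endpoint, so passing to the limit costs only the error in mean, which
  is arbitrarily small.\<close>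

lemma E_quadratic_variation:
  assumes QV: "quadratic_variation L E (\<lambda>t \<omega>. B t \<omega> $ i) Q" and c: "\<bar>c\<bar> = 1"
  shows "E (\<lambda>\<omega>. c * Q 1 \<omega>) = (SUP C\<in>cov. c * C $ i $ i)"
proof -
  have QL: "Q 1 \<in> L" using QV by (simp add: quadratic_variation_def)
  have "\<bar>E (\<lambda>\<omega>. c * (B 1 \<omega> $ i)\<^sup>2) - E (\<lambda>\<omega>. c * Q 1 \<omega>)\<bar> \<le> \<epsilon>" if \<epsilon>: "\<epsilon> > 0" for \<epsilon>
  proof -
    have "\<exists>\<delta>>0. \<forall>n s. s 0 = 0 \<and> s n = 1 \<and> (\<forall>k<n. s k \<le> s (Suc k) \<and> s (Suc k) - s k < \<delta>) \<longrightarrow>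
        E (\<lambda>\<omega>. \<bar>(\<Sum>k<n. (B (s (Suc k)) \<omega> $ i - B (s k) \<omega> $ i)\<^sup>2) - Q 1 \<omega>\<bar>) < \<epsilon>"
      using QV[unfolded quadratic_variation_def, THEN spec, of 1] \<epsilon> by simp
    then obtain \<delta> where \<delta>: "\<delta> > 0" and lim: "\<And>n s. s 0 = 0 \<and> s n = 1 \<and>
        (\<forall>k<n. s k \<le> s (Suc k) \<and> s (Suc k) - s k < \<delta>) \<Longrightarrow>
        E (\<lambda>\<omega>. \<bar>(\<Sum>k<n. (B (s (Suc k)) \<omega> $ i - B (s k) \<omega> $ i)\<^sup>2) - Q 1 \<omega>\<bar>) < \<epsilon>"
      by (elim exE conjE) simp
    obtain n :: nat where n: "n > 0" "1 / n < \<delta>"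
      using reals_Archimedean[OF \<delta>] by (metis zero_less_Suc inverse_eq_divide)
    define d where "d = 1 / real n"
    have d: "d \<ge> 0" "n * d = 1" "d < \<delta>" using n by (auto simp: d_def)
    define V where "V \<omega> = (\<Sum>k<n. (B (Suc k * d) \<omega> $ i - B (k * d) \<omega> $ i)\<^sup>2)" for \<omega>
    have VL: "V \<in> L" unfolding V_def by (intro L_sum_increment_squares d)
    have "E (\<lambda>\<omega>. c * V \<omega>) = E (\<lambda>\<omega>. c * (B 1 \<omega> $ i)\<^sup>2)"
      unfolding V_def E_sum_increment_squares[OF d(1)] d(2) by simp
    moreover have "\<bar>E (\<lambda>\<omega>. c * V \<omega>) - E (\<lambda>\<omega>. c * Q 1 \<omega>)\<bar> \<le> E (\<lambda>\<omega>. \<bar>c * V \<omega> - c * Q 1 \<omega>\<bar>)"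
      by (intro E_diff_le_abs L_cmult VL QL)
    moreover have "\<bar>c * V \<omega> - c * Q 1 \<omega>\<bar> = \<bar>V \<omega> - Q 1 \<omega>\<bar>" for \<omega>
      using c by (simp add: abs_mult flip: right_diff_distrib)
    moreover have "E (\<lambda>\<omega>. \<bar>V \<omega> - Q 1 \<omega>\<bar>) < \<epsilon>"
      unfolding V_def using d by (intro lim[of "\<lambda>k. k * d"]) (auto simp: algebra_simps)
    ultimately show ?thesis by simp
  qed
  then have "\<bar>E (\<lambda>\<omega>. c * (B 1 \<omega> $ i)\<^sup>2) - E (\<lambda>\<omega>. c * Q 1 \<omega>)\<bar> \<le> 0"
    by (rule field_le_epsilon) simp
  then show ?thesis using E_B_product[of 1 c i i] by (simp add: power2_eq_square)
qed

section \<open>Extreme variances and the effect of pairwise independence\<close>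

definition "var_hi i = E (\<lambda>\<omega>. (B 1 \<omega> $ i)\<^sup>2)"
definition "var_lo i = - E (\<lambda>\<omega>. - (B 1 \<omega> $ i)\<^sup>2)"

lemma E_indep_product_zero:
  assumes "indep_process E (\<lambda>t \<omega>. B t \<omega> $ j) (\<lambda>t \<omega>. B t \<omega> $ i)"
  shows "E (\<lambda>\<omega>. c * (B 1 \<omega> $ i * B 1 \<omega> $ j)) = 0"
proof -
  have \<phi>: "(\<lambda>p. c * (fst p 0 * snd p 0)) \<in> C_lLip (pair_norm 1 1 :: (nat \<Rightarrow> real) \<times> (nat \<Rightarrow> real) \<Rightarrow> real)"
    by (intro C_lLip_cmult C_lLip_mult C_lLip_pair_fst[where g = "\<lambda>x. x"]
        C_lLip_pair_snd[where g = "\<lambda>x. x"] lip_gauge_pair_norm) auto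
  have "indep_vector E 1 (\<lambda>k \<omega>. B 1 \<omega> $ j) 1 (\<lambda>k \<omega>. B 1 \<omega> $ i)"
    using assms unfolding indep_process_def by (auto dest!: spec[of _ "1::nat"] spec[of _ "\<lambda>_. 1::real"])
  from indep_vectorD[OF this \<phi>]
  show ?thesis using E_cmult_B[of 1 "c * _" j] by (simp add: mult.assoc E_const)
qed


lemma E_cmult_increment:
  assumes "s \<ge> 0" "t \<ge> 0"
  shows "E (\<lambda>\<omega>. c * (B (s + t) \<omega> $ i - B s \<omega> $ i)) = 0"
  using stationary[OF C_lLip_cmult[OF lip_gauge_norm C_lLip_nth] assms, of c i] E_cmult_B[OF assms(2)]
  by simp

lemma var_lo_le_var_hi: "var_lo i \<le> var_hi i"
  unfolding var_lo_def var_hi_def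
  using E_add_uminus_nonneg[OF L_rv[OF rv_power[OF rv_nth[of 0 1 "\<lambda>_. 1" i]]], of 2] by simp

text \<open>The increment \<open>Z\<close> of $B^i$ after time 1 and \<open>Y\<close>, the value of $B^j$ at time 1, are independent
  of each other in both orders. Evaluating \<open>E (Y * Z\<^sup>2)\<close> in the two orders gives \<open>0\<close> and
  \<open>(var_hi i - var_lo i) / 2 * E \<bar>Y\<bar>\<close>; likewise for \<open>E (Z * Y\<^sup>2)\<close>.\<close>
lemma indep_process_degenerate:
  assumes "indep_process E (\<lambda>t \<omega>. B t \<omega> $ j) (\<lambda>t \<omega>. B t \<omega> $ i)"
  shows "var_lo i = var_hi i \<or> var_hi j \<le> 0" and "var_lo j = var_hi j \<or> var_hi i \<le> 0"
proof -
  define \<tau> :: "nat \<Rightarrow> real" where "\<tau> k = (if k = 0 then 1 else 2)" for k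
  define Y where "Y \<omega> = B 1 \<omega> $ j" for \<omega>
  define Z where "Z \<omega> = B 2 \<omega> $ i - B 1 \<omega> $ i" for \<omega>
  have Yrv: "Y \<in> rv 2 \<tau>" unfolding Y_def using rv_nth[of 0 2 \<tau> j] by (simp add: \<tau>_def)
  have Zrv: "Z \<in> rv 2 \<tau>" unfolding Z_def
    using rv_diff[OF rv_nth[of 1 2 \<tau> i] rv_nth[of 0 2 \<tau> i]] by (simp add: \<tau>_def)
  have inL: "X \<in> L" if "X \<in> rv 2 \<tau>" for X by (rule L_rv[OF that]) (simp add: \<tau>_def)
  have pastinc: "indep_vector E 1 (\<lambda>_ \<omega>. B 2 \<omega> - B 1 \<omega>) 1 (\<lambda>_. B 1)"
    using indep_increment[of 1 1 "\<lambda>_. 1" 1] by simp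
  \<comment> \<open>Independence of processes places no order on the two sets of times: the earlier
    value of one component is independent of later values of the other. This gives the order of
    freezing opposite to that of \<open>pastinc\<close>.\<close>
  have comps: "indep_vector E 1 (\<lambda>_ \<omega>. B 1 \<omega> $ j) 2 (\<lambda>k \<omega>. B (\<tau> k) \<omega> $ i)"
    using assms[unfolded indep_process_def, rule_format, of \<tau> "\<lambda>_. 1" 1 2] by (simp add: \<tau>_def)
  have zero1: "E (\<lambda>\<omega>. c * Y \<omega>) = 0" "E (\<lambda>\<omega>. c * Z \<omega>) = 0" for c
    unfolding Y_def Z_def using E_cmult_B[of 1 c j] E_cmult_increment[of 1 1 c i] by simp_all
  have sq: "E (\<lambda>\<omega>. (Z \<omega>)\<^sup>2) = var_hi i" "E (\<lambda>\<omega>. - (Z \<omega>)\<^sup>2) = - var_lo i"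
    "E (\<lambda>\<omega>. (Y \<omega>)\<^sup>2) = var_hi j" "E (\<lambda>\<omega>. - (Y \<omega>)\<^sup>2) = - var_lo j"
    unfolding Y_def Z_def var_hi_def var_lo_def
    using E_increment_square[of 1 1 1 i] E_increment_square[of 1 1 "-1" i] by simp_all
  have E_affine: "E (\<lambda>\<omega>. d * \<bar>X \<omega>\<bar> + m * X \<omega>) = d * E (\<lambda>\<omega>. \<bar>X \<omega>\<bar>)"
    if "X \<in> L" "d \<ge> 0" "\<And>c. E (\<lambda>\<omega>. c * X \<omega>) = 0" for X d m
    using E_add_certain[OF L_cmult[OF L_abs[OF that(1)]] L_cmult[OF that(1)], of m 0 d]
      E_cmult[OF L_abs[OF that(1)] that(2)] that(3)[of m] that(3)[of "- m"] by simp
  note pair_intros = C_lLip_mult C_lLip_power C_lLip_diff lip_gauge_pair_norm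
    C_lLip_pair_fst C_lLip_pair_snd abs_nth_diff_le_norm
  note pair_real = C_lLip_pair_fst[where g = "\<lambda>x :: real. x"] C_lLip_pair_snd[where g = "\<lambda>x :: real. x"]
  have \<phi>1: "(\<lambda>p. fst p 0 $ j * (snd p 0 $ i)\<^sup>2) \<in> C_lLip (pair_norm 1 1 :: (nat \<Rightarrow> real^'d) \<times> (nat \<Rightarrow> real^'d) \<Rightarrow> real)"
    by (intro pair_intros) simp_all
  have \<phi>2: "(\<lambda>p. (fst p 0 $ j)\<^sup>2 * snd p 0 $ i) \<in> C_lLip (pair_norm 1 1 :: (nat \<Rightarrow> real^'d) \<times> (nat \<Rightarrow> real^'d) \<Rightarrow> real)"
    by (intro pair_intros) simp_all
  have \<phi>3: "(\<lambda>p. (fst p 1 - fst p 0)\<^sup>2 * snd p 0) \<in> C_lLip (pair_norm 2 1 :: (nat \<Rightarrow> real) \<times> (nat \<Rightarrow> real) \<Rightarrow> real)"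
    by (intro C_lLip_mult C_lLip_power C_lLip_diff lip_gauge_pair_norm pair_real) simp_all
  have \<phi>4: "(\<lambda>p. (fst p 1 - fst p 0) * (snd p 0)\<^sup>2) \<in> C_lLip (pair_norm 2 1 :: (nat \<Rightarrow> real) \<times> (nat \<Rightarrow> real) \<Rightarrow> real)"
    by (intro C_lLip_mult C_lLip_power C_lLip_diff lip_gauge_pair_norm pair_real) simp_all
  have "E (\<lambda>\<omega>. Y \<omega> * (Z \<omega>)\<^sup>2) = E (\<lambda>\<omega>. E (\<lambda>\<omega>'. Y \<omega> * (Z \<omega>')\<^sup>2))"
    using indep_vectorD[OF pastinc \<phi>1] by (simp add: Y_def Z_def)
  \<comment> \<open>For frozen \<open>Y\<close> the square of \<open>Z\<close> is weighted by a
    number of known sign, which selects one extreme variance. The part linear in \<open>Y\<close> is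
    centred and disappears in the next step.\<close>
  also have "\<dots> = E (\<lambda>\<omega>. (var_hi i - var_lo i) / 2 * \<bar>Y \<omega>\<bar> + (var_hi i + var_lo i) / 2 * Y \<omega>)"
    using E_cmult_max[OF inL[OF rv_power[OF Zrv]], of _ 2] by (simp add: sq)
  also have "\<dots> = (var_hi i - var_lo i) / 2 * E (\<lambda>\<omega>. \<bar>Y \<omega>\<bar>)"
    using var_lo_le_var_hi by (intro E_affine inL Yrv zero1) simp
  finally have 1: "E (\<lambda>\<omega>. Y \<omega> * (Z \<omega>)\<^sup>2) = (var_hi i - var_lo i) / 2 * E (\<lambda>\<omega>. \<bar>Y \<omega>\<bar>)" .
  have "E (\<lambda>\<omega>. (Z \<omega>)\<^sup>2 * Y \<omega>) = E (\<lambda>\<omega>. E (\<lambda>\<omega>'. (Z \<omega>)\<^sup>2 * Y \<omega>'))"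
    using indep_vectorD[OF comps \<phi>3] by (simp add: Y_def Z_def \<tau>_def)
  then have 3: "E (\<lambda>\<omega>. Y \<omega> * (Z \<omega>)\<^sup>2) = 0"
    unfolding zero1 E_const by (simp only: mult.commute)
  have "E (\<lambda>\<omega>. Z \<omega> * (Y \<omega>)\<^sup>2) = E (\<lambda>\<omega>. E (\<lambda>\<omega>'. Z \<omega> * (Y \<omega>')\<^sup>2))"
    using indep_vectorD[OF comps \<phi>4] by (simp add: Y_def Z_def \<tau>_def)
  also have "\<dots> = E (\<lambda>\<omega>. (var_hi j - var_lo j) / 2 * \<bar>Z \<omega>\<bar> + (var_hi j + var_lo j) / 2 * Z \<omega>)"
    using E_cmult_max[OF inL[OF rv_power[OF Yrv]], of _ 2] by (simp add: sq)
  also have "\<dots> = (var_hi j - var_lo j) / 2 * E (\<lambda>\<omega>. \<bar>Z \<omega>\<bar>)"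
    using var_lo_le_var_hi by (intro E_affine inL Zrv zero1) simp
  finally have 4: "E (\<lambda>\<omega>. Z \<omega> * (Y \<omega>)\<^sup>2) = (var_hi j - var_lo j) / 2 * E (\<lambda>\<omega>. \<bar>Z \<omega>\<bar>)" .
  have "E (\<lambda>\<omega>. (Y \<omega>)\<^sup>2 * Z \<omega>) = E (\<lambda>\<omega>. E (\<lambda>\<omega>'. (Y \<omega>)\<^sup>2 * Z \<omega>'))"
    using indep_vectorD[OF pastinc \<phi>2] by (simp add: Y_def Z_def)
  then have 2: "E (\<lambda>\<omega>. Z \<omega> * (Y \<omega>)\<^sup>2) = 0"
    unfolding zero1 E_const by (simp only: mult.commute)
  have *: "E (\<lambda>\<omega>. (X \<omega>)\<^sup>2) \<le> 0" if "X \<in> rv 2 \<tau>" "E (\<lambda>\<omega>. \<bar>X \<omega>\<bar>) = 0" for X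
    using that by (intro E_square_zero_if_E_abs_zero inL rv_power)
  show "var_lo i = var_hi i \<or> var_hi j \<le> 0" using 1 3 *[OF Yrv] by (auto simp: sq)
  show "var_lo j = var_hi j \<or> var_hi i \<le> 0" using 4 2 *[OF Zrv] by (auto simp: sq)
qed

text \<open>These are the suprema that \<open>E_quadratic_variation\<close> produces for
  \<open>c = 1\<close> and \<open>c = -1\<close>, which links second moments at time 1 with the
  bounds of the quadratic variation.\<close>

lemma var_hi_eq: "var_hi i = (SUP C\<in>cov. C $ i $ i)"
  and var_lo_eq: "var_lo i = - (SUP C\<in>cov. - C $ i $ i)"
  using E_B_product[of 1 1 i i] E_B_product[of 1 "-1" i i]
  by (simp_all add: var_hi_def var_lo_def power2_eq_square)

lemma continuous_on_entry: "continuous_on T (\<lambda>C :: real^'d^'d. C $ i $ j)"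
  by (intro continuous_intros)

lemma cov_diag_bounds:
  assumes "C \<in> cov"
  shows "var_lo i \<le> C $ i $ i" "C $ i $ i \<le> var_hi i"
proof -
  show "C $ i $ i \<le> var_hi i" unfolding var_hi_eq
    by (intro cSUP_upper assms bdd_above_cov continuous_on_entry)
  have "- C $ i $ i \<le> (SUP C\<in>cov. - C $ i $ i)"
    by (intro cSUP_upper[of C cov "\<lambda>C. - C $ i $ i"] assms bdd_above_cov continuous_intros)
  then show "var_lo i \<le> C $ i $ i" unfolding var_lo_eq by simp
qed

lemma cov_attains_var_hi: "\<exists>C\<in>cov. C $ i $ i = var_hi i"
proof -
  obtain C where C: "C \<in> cov" "\<forall>D\<in>cov. D $ i $ i \<le> C $ i $ i"
    using continuous_attains_sup[OF cov_nonempty_compact(2,1) continuous_on_entry] by (rule bexE)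
  have "var_hi i \<le> C $ i $ i"
    unfolding var_hi_eq using C(2) by (intro cSUP_least[OF cov_nonempty_compact(1)]) (rule bspec)
  then have "C $ i $ i = var_hi i" using cov_diag_bounds(2)[OF C(1)] by (rule antisym[rotated])
  then show ?thesis using C(1) by (rule bexI)
qed

lemma cov_attains_var_lo: "\<exists>C\<in>cov. C $ i $ i = var_lo i"
proof -
  obtain C where C: "C \<in> cov" "\<forall>D\<in>cov. C $ i $ i \<le> D $ i $ i"
    using continuous_attains_inf[OF cov_nonempty_compact(2,1) continuous_on_entry] by (rule bexE)
  have "(SUP C\<in>cov. - C $ i $ i) \<le> - C $ i $ i"
    by (intro cSUP_least[OF cov_nonempty_compact(1)] le_imp_neg_le) (rule bspec[OF C(2)])
  then have "C $ i $ i \<le> var_lo i" unfolding var_lo_eq by linarith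
  then have "C $ i $ i = var_lo i" using cov_diag_bounds(1)[OF C(1)] by (rule antisym)
  then show ?thesis using C(1) by (rule bexI)
qed

lemma var_lo_nonneg: "0 \<le> var_lo i"
proof -
  obtain C where C: "C \<in> cov" "C $ i $ i = var_lo i" using cov_attains_var_lo[of i] by (rule bexE)
  show ?thesis using cov_diag_nonneg[OF C(1), of i] by (simp add: C(2))
qed

text \<open>The mixed moment is the supremum of \<open>c * C $ i $ j\<close> over
  \<open>cov\<close>. Its vanishing for both signs of \<open>c\<close> bounds each entry by 0 from
  both sides.\<close>

lemma indep_process_entry_zero:
  assumes "indep_process E (\<lambda>t \<omega>. B t \<omega> $ j) (\<lambda>t \<omega>. B t \<omega> $ i)" and "C \<in> cov"
  shows "C $ i $ j = 0"
proof -
  have "c * C $ i $ j \<le> 0" for c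
  proof -
    have "c * C $ i $ j \<le> (SUP C\<in>cov. c * C $ i $ j)"
      by (intro cSUP_upper[of C cov "\<lambda>C. c * C $ i $ j"] assms bdd_above_cov continuous_intros)
    then show ?thesis using E_B_product[of 1 c i j] E_indep_product_zero[OF assms(1), of c] by simp
  qed
  from this[of 1] this[of "-1"] show ?thesis by simp
qed

end

section \<open>Independent components\<close>

lemma diag_matrix_nth [simp]: "diag_matrix g $ i $ j = (if i = j then g i else 0)"
  by (simp add: diag_matrix_def)

definition diag_box :: "('d \<Rightarrow> real) \<Rightarrow> ('d \<Rightarrow> real) \<Rightarrow> (real^'d^'d::finite) set" where
  "diag_box lo hi = {diag_matrix c |c. \<forall>i. c i \<in> {lo i..hi i}}"

lemma mem_diag_box_iff:
  "A \<in> diag_box lo hi \<longleftrightarrow> (\<forall>i j. i \<noteq> j \<longrightarrow> A $ i $ j = 0) \<and> (\<forall>i. lo i \<le> A $ i $ i \<and> A $ i $ i \<le> hi i)"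
proof
  assume "(\<forall>i j. i \<noteq> j \<longrightarrow> A $ i $ j = 0) \<and> (\<forall>i. lo i \<le> A $ i $ i \<and> A $ i $ i \<le> hi i)"
  then show "A \<in> diag_box lo hi" unfolding diag_box_def
    by (intro CollectI exI[of _ "\<lambda>i. A $ i $ i"]) (auto simp: vec_eq_iff)
qed (auto simp: diag_box_def)

lemma convex_diag_box: "convex (diag_box lo hi)"
proof (rule convexI)
  fix X Y and u v :: real
  assume *: "X \<in> diag_box lo hi" "Y \<in> diag_box lo hi" "0 \<le> u" "0 \<le> v" "u + v = 1"
  have "u * X $ i $ i + v * Y $ i $ i \<in> {lo i..hi i}" for i
    using convexD[OF convex_real_interval(5)[of "lo i" "hi i"], of "X $ i $ i" "Y $ i $ i" u v] *
    by (simp add: mem_diag_box_iff)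
  then show "u *\<^sub>R X + v *\<^sub>R Y \<in> diag_box lo hi" using * by (simp add: mem_diag_box_iff)
qed

text \<open>Square roots of the diagonal reach every point of the box, which is where nonnegative
  lower bounds matter; the box is convex, so the hull adds nothing.\<close>

lemma covariances_diag:
  assumes "\<And>i. 0 \<le> lo i"
  shows "covariances {diag_matrix g |g. \<forall>i. (g i)\<^sup>2 \<in> {lo i..hi i}} = diag_box lo hi"
proof -
  have dd: "diag_matrix g ** transpose (diag_matrix g) = diag_matrix (\<lambda>i. (g i)\<^sup>2)" for g :: "'a \<Rightarrow> real"
    by (simp add: vec_eq_iff matrix_matrix_mult_def transpose_def power2_eq_square if_distrib[of "\<lambda>x. _ * x"]
        sum.delta cong: if_cong)
  have "(\<lambda>\<gamma>. \<gamma> ** transpose \<gamma>) ` {diag_matrix g |g. \<forall>i. (g i)\<^sup>2 \<in> {lo i..hi i}} = diag_box lo hi"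
  proof (intro equalityI subsetI)
    fix A assume "A \<in> diag_box lo hi"
    then obtain c where c: "A = diag_matrix c" "\<And>i. c i \<in> {lo i..hi i}" by (auto simp: diag_box_def)
    have c2: "(sqrt (c i))\<^sup>2 = c i" for i using c(2)[of i] assms[of i] by simp
    have "A = diag_matrix (\<lambda>i. sqrt (c i)) ** transpose (diag_matrix (\<lambda>i. sqrt (c i)))"
      "\<forall>i. (sqrt (c i))\<^sup>2 \<in> {lo i..hi i}" using c unfolding dd c2 by simp_all
    then show "A \<in> (\<lambda>\<gamma>. \<gamma> ** transpose \<gamma>) ` {diag_matrix g |g. \<forall>i. (g i)\<^sup>2 \<in> {lo i..hi i}}" by blast
  qed (auto simp: dd diag_box_def)
  then show ?thesis unfolding covariances_def by (simp add: convex_diag_box hull_same)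
qed

text \<open>A linear functional bounded on a set is equally bounded on its hull. This allows the
  supremum over \<open>cov\<close> to be tested at corners of the box, which are known only to lie
  in the hull.\<close>

lemma le_on_convex_hull_trace:
  fixes A :: "real^'d^'d::finite"
  assumes "C \<in> convex hull T" and "\<And>D. D \<in> T \<Longrightarrow> trace (D ** A) \<le> s"
  shows "trace (C ** A) \<le> s"
proof -
  have lin: "trace ((u *\<^sub>R X + v *\<^sub>R Y) ** A) = u * trace (X ** A) + v * trace (Y ** A)" for u v X Y
    by (simp add: trace_mult_eq_sum sum.distrib sum_distrib_left algebra_simps)
  have "convex {D. trace (D ** A) \<le> s}"
  proof (rule convexI)
    fix X Y and u v :: real
    assume "X \<in> {D. trace (D ** A) \<le> s}" "Y \<in> {D. trace (D ** A) \<le> s}" "0 \<le> u" "0 \<le> v" "u + v = 1"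
    then show "u *\<^sub>R X + v *\<^sub>R Y \<in> {D. trace (D ** A) \<le> s}"
      unfolding mem_Collect_eq lin by (intro convex_bound_le) auto
  qed
  then have "convex hull T \<subseteq> {D. trace (D ** A) \<le> s}" using assms(2) by (intro hull_minimal) auto
  then show ?thesis using assms(1) by blast
qed

locale indep_G_expectation_space = G_expectation_space \<Gamma> L E
  for \<Gamma> :: "(real^('d::{finite,linorder})^('d::{finite,linorder})) set" and L E +
  assumes indep: "i < j \<Longrightarrow> indep_process E (\<lambda>t \<omega>. B t \<omega> $ j) (\<lambda>t \<omega>. B t \<omega> $ i)"
begin

lemma cov_offdiag:
  assumes "C \<in> cov" "i \<noteq> j"
  shows "C $ i $ j = 0"
proof (cases "i < j")
  case True
  then show ?thesis by (intro indep_process_entry_zero[OF indep assms(1)])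
next
  case False
  then have "C $ j $ i = 0" using assms(2) by (intro indep_process_entry_zero[OF indep assms(1)]) simp
  then show ?thesis using cov_symmetric[OF assms(1)] by simp
qed

lemma degenerate:
  assumes "i \<noteq> j"
  shows "var_lo i = var_hi i \<or> var_hi j \<le> 0"
proof (cases "i < j")
  case True
  then show ?thesis by (intro indep_process_degenerate(1)[OF indep])
next
  case False
  then show ?thesis using assms by (intro indep_process_degenerate(2)[OF indep]) simp
qed

lemma cov_subset_diag_box: "cov \<subseteq> diag_box var_lo var_hi"
proof
  fix C assume C: "C \<in> cov"
  show "C \<in> diag_box var_lo var_hi"
    unfolding mem_diag_box_iff using cov_offdiag[OF C] cov_diag_bounds[OF C] by simp
qed

lemma covariances_eq_diag_box: "covariances \<Gamma> = diag_box var_lo var_hi"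
proof
  show "covariances \<Gamma> \<subseteq> diag_box var_lo var_hi"
    unfolding covariances_def by (intro hull_minimal cov_subset_diag_box convex_diag_box)
  show "diag_box var_lo var_hi \<subseteq> covariances \<Gamma>"
  proof
    fix A assume A: "A \<in> diag_box var_lo var_hi"
    show "A \<in> covariances \<Gamma>"
    proof (cases "\<exists>i. var_lo i \<noteq> var_hi i")
      case False
      obtain C where C: "C \<in> cov" using cov_nonempty_compact(1) by blast
      with cov_subset_diag_box have "C \<in> diag_box var_lo var_hi" by blast
      with A False have "A = C"
        by (simp add: mem_diag_box_iff vec_eq_iff) (metis order_antisym)
      then show ?thesis using C unfolding covariances_def by (simp add: hull_inc)
    next
      case True
      then obtain i where i: "var_lo i \<noteq> var_hi i" by blast
      \<comment> \<open>One uncertain component forces all the others to have variance 0, so the box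
        is a segment along the entry \<open>i\<close>.\<close>
      have zero: "D $ j $ j = 0" if "D \<in> diag_box var_lo var_hi" "j \<noteq> i" for D j
      proof -
        have "var_hi j \<le> 0" using degenerate[of i j] i that(2) by blast
        moreover have "var_lo j \<le> D $ j $ j" "D $ j $ j \<le> var_hi j"
          using that(1) unfolding mem_diag_box_iff by blast+
        ultimately show ?thesis using var_lo_nonneg[of j] by linarith
      qed
      obtain C where C: "C \<in> cov" "C $ i $ i = var_lo i" using cov_attains_var_lo[of i] by (rule bexE)
      obtain D where D: "D \<in> cov" "D $ i $ i = var_hi i" using cov_attains_var_hi[of i] by (rule bexE)
      \<comment> \<open>Position of \<open>A\<close> on the segment between two members of
        \<open>cov\<close> that attain the extreme variances of component \<open>i\<close>.\<close>
      define u where "u = (A $ i $ i - var_lo i) / (var_hi i - var_lo i)"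
      have lt: "var_lo i < var_hi i" using i var_lo_le_var_hi[of i] by simp
      have u: "0 \<le> u" "u \<le> 1" using A lt by (auto simp: u_def mem_diag_box_iff)
      have "(1 - u) *\<^sub>R C + u *\<^sub>R D \<in> covariances \<Gamma>"
        unfolding covariances_def by (intro convexD_alt[OF convex_convex_hull] hull_inc C D u)
      moreover have "(1 - u) *\<^sub>R C + u *\<^sub>R D = A"
      proof -
        have box: "C \<in> diag_box var_lo var_hi" "D \<in> diag_box var_lo var_hi"
          using C D cov_subset_diag_box by blast+
        have "u * (var_hi i - var_lo i) = A $ i $ i - var_lo i" using lt by (simp add: u_def)
        then have "(1 - u) * C $ i $ i + u * D $ i $ i = A $ i $ i" by (simp add: C D algebra_simps)
        moreover have "(1 - u) * C $ j $ k + u * D $ j $ k = A $ j $ k" if "\<not> (j = i \<and> k = i)" for j k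
        proof (cases "j = k")
          case True
          then show ?thesis using zero[OF box(1)] zero[OF box(2)] zero[OF A] that by simp
        next
          case False
          then show ?thesis using box A by (simp add: mem_diag_box_iff)
        qed
        ultimately have "(1 - u) * C $ j $ k + u * D $ j $ k = A $ j $ k" for j k
          by (cases "j = i \<and> k = i") auto
        then show ?thesis by (simp add: vec_eq_iff)
      qed
      ultimately show ?thesis by simp
    qed
  qed
qed

lemma G_upper_uminus:
  "- G_upper \<Gamma> (- A) = (\<Sum>i\<in>UNIV. var_lo i * max (A $ i $ i) 0 - var_hi i * max (- (A $ i $ i)) 0) / 2"
proof -
  let ?s = "\<Sum>i\<in>UNIV. var_hi i * max (- (A $ i $ i)) 0 - var_lo i * max (A $ i $ i) 0"
  have tr: "trace (C ** (- A)) = (\<Sum>i\<in>UNIV. C $ i $ i * - A $ i $ i)"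
    if "C \<in> diag_box var_lo var_hi" for C
    unfolding trace_mult_eq_sum
  proof (intro sum.cong refl)
    fix i
    have "(\<Sum>k\<in>UNIV. C $ i $ k * (- A) $ k $ i) = (\<Sum>k\<in>UNIV. if k = i then C $ i $ i * - A $ i $ i else 0)"
      using that by (intro sum.cong refl) (auto simp: mem_diag_box_iff)
    then show "(\<Sum>k\<in>UNIV. C $ i $ k * (- A) $ k $ i) = C $ i $ i * - A $ i $ i" by simp
  qed
  have "(SUP C\<in>cov. trace (C ** (- A))) = ?s"
  proof (rule antisym)
    show "(SUP C\<in>cov. trace (C ** (- A))) \<le> ?s"
    proof (rule cSUP_least[OF cov_nonempty_compact(1)])
      fix C assume C: "C \<in> cov"
      have "C $ i $ i * - A $ i $ i \<le> var_hi i * max (- (A $ i $ i)) 0 - var_lo i * max (A $ i $ i) 0" for i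
        using mult_right_mono[OF cov_diag_bounds(1)[OF C, of i], of "A $ i $ i"]
          mult_right_mono[OF cov_diag_bounds(2)[OF C, of i], of "- A $ i $ i"]
        by (cases "A $ i $ i \<ge> 0") (auto simp: max_def)
      then show "trace (C ** (- A)) \<le> ?s"
        using C cov_subset_diag_box by (subst tr) (auto intro: sum_mono)
    qed
    \<comment> \<open>The maximising corner: the functional weights \<open>C $ i $ i\<close> by
      \<open>- A $ i $ i\<close>, so a nonnegative entry of \<open>A\<close> asks for the smallest
      variance and a negative one for the largest.\<close>
    define C where "C = diag_matrix (\<lambda>i. if A $ i $ i \<ge> 0 then var_lo i else var_hi i)"
    have C: "C \<in> diag_box var_lo var_hi" using var_lo_le_var_hi by (simp add: mem_diag_box_iff C_def)
    have "?s = trace (C ** (- A))"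
      unfolding tr[OF C] by (intro sum.cong refl) (auto simp: C_def max_def)
    also have "\<dots> \<le> (SUP C\<in>cov. trace (C ** (- A)))"
      using C unfolding covariances_eq_diag_box[symmetric] covariances_def
      by (rule le_on_convex_hull_trace)
        (intro cSUP_upper[of _ cov "\<lambda>C. trace (C ** (- A))"] bdd_above_cov continuous_on_trace_mult)
    finally show "?s \<le> (SUP C\<in>cov. trace (C ** (- A)))" .
  qed
  then show ?thesis unfolding G_upper_eq by (simp add: sum_subtractf field_simps)
qed

lemma viscosity_lower_expectation:
  assumes "\<phi> \<in> C_lLip norm"
  shows "viscosity_solution (\<lambda>A. (\<Sum>i\<in>UNIV. var_lo i * max (A $ i $ i) 0 - var_hi i * max (- (A $ i $ i)) 0) / 2)
    \<phi> (\<lambda>t x. lower_expectation E (\<lambda>\<omega>. \<phi> (x + B t \<omega>)))"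
proof -
  have "(\<lambda>x. - \<phi> x) \<in> C_lLip norm"
    using C_lLip_cmult[OF lip_gauge_norm assms, of "-1"] by simp
  from viscosity_solution_uminus[OF viscosity_E[OF this]]
  show ?thesis by (simp add: lower_expectation_def G_upper_uminus)
qed

end

theorem proposition2p5:
  fixes \<Gamma> :: "(real^('d::{finite,linorder})^('d::{finite,linorder})) set"
    and L :: "(('d::{finite,linorder}) cpath \<Rightarrow> real) set"
    and E :: "(('d::{finite,linorder}) cpath \<Rightarrow> real) \<Rightarrow> real"
    and QV :: "('d::{finite,linorder}) \<Rightarrow> real \<Rightarrow> ('d::{finite,linorder}) cpath \<Rightarrow> real"
    and \<sigma>_hi \<sigma>_lo :: "('d::{finite,linorder}) \<Rightarrow> real"
  assumes "\<Gamma> \<noteq> {}" and "bounded \<Gamma>" and "closed \<Gamma>"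
    and "G_expectation \<Gamma> L E"
    and "\<And>i. quadratic_variation L E (\<lambda>t \<omega>. B t \<omega> $ i) (QV i)"
    and "\<And>i. (\<sigma>_hi i)\<^sup>2 = E (QV i 1)"
    and "\<And>i. (\<sigma>_lo i)\<^sup>2 = lower_expectation E (QV i 1)"
    and "\<And>i j. i < j \<Longrightarrow> indep_process E (\<lambda>t \<omega>. B t \<omega> $ j) (\<lambda>t \<omega>. B t \<omega> $ i)"
  shows "(\<forall>\<phi>\<in>C_lLip norm.
            viscosity_solution
              (\<lambda>A. (\<Sum>i\<in>UNIV. (\<sigma>_lo i)\<^sup>2 * max (A $ i $ i) 0
                              - (\<sigma>_hi i)\<^sup>2 * max (- (A $ i $ i)) 0) / 2)
              \<phi> (\<lambda>t x. lower_expectation E (\<lambda>\<omega>. \<phi> (x + B t \<omega>)))) \<and>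
         covariances \<Gamma> =
           covariances {diag_matrix g |g. \<forall>i. (g i)\<^sup>2 \<in> {(\<sigma>_lo i)\<^sup>2..(\<sigma>_hi i)\<^sup>2}}"
proof -
  interpret indep_G_expectation_space \<Gamma> L E
    using assms(1-4,8) by unfold_locales
  have hi: "(\<sigma>_hi i)\<^sup>2 = var_hi i" for i
    using E_quadratic_variation[OF assms(5), of 1 i] by (simp add: assms(6) var_hi_eq)
  have lo: "(\<sigma>_lo i)\<^sup>2 = var_lo i" for i
    using E_quadratic_variation[OF assms(5), of "-1" i]
    by (simp add: assms(7) var_lo_eq lower_expectation_def)
  show ?thesis unfolding hi lo
  proof (intro conjI ballI)
    show "covariances \<Gamma> = covariances {diag_matrix g |g. \<forall>i. (g i)\<^sup>2 \<in> {var_lo i..var_hi i}}"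
      unfolding covariances_eq_diag_box by (rule covariances_diag[OF var_lo_nonneg, symmetric])
  qed (rule viscosity_lower_expectation)
qed

end
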